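(* (In $\mathrm{ZF}$.) $\mathrm{4RC_{fin}}$ implies $\mathrm{C^-_3}$.
   Context: The base theory is $\mathrm{ZF}$ (no Axiom of Choice). For a set $x$ and $n\in\omega$, $[x]^n$ is the set of all $n$-element subsets of $x$ and $[x]^{>n}$ is the set of all finite subsets of $x$ with more than $n$ elements. $\mathrm{nRC_{fin}}$: given any infinite set $x$, there exist an infinite subset $y\subseteq x$ and a function $f\colon[y]^{>n}\to[y]^n$ such that $f(z)\subseteq z$ for all $z\in[y]^{>n}$. $\mathrm{C^-_n}$: given any infinite family $\mathcal F$ of non-empty sets of cardinality $n$, there exist an infinite subfamily $\mathcal A\subseteq\mathcal F$ and a function $f\colon\mathcal A\to\bigcup\mathcal A$ such that $f(A)\in A$ for all $A\in\mathcal A$. *)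

theory Defs
  imports Main
begin

text \<open>
  HOL itself validates the Axiom of Choice, so a statement about \<open>ZF\<close> without choice cannot be
  phrased with HOL sets.  It is phrased here about an arbitrary model of first-order \<open>ZF\<close>: a type
  \<^typ>\<open>'a\<close> of ``sets'' with a binary membership relation.  All set-theoretic notions
  below are first-order over that structure: every quantifier ranges over elements of the model, and
  finiteness, functions and cardinality are those of the model.

  Separation and Replacement must be restricted to first-order formulas.  Stated for
  arbitrary HOL predicates they would, through Hilbert choice in the metatheory, force the model
  to satisfy the Axiom of Choice.
\<close>

datatype form =
    Mem nat nat
  | Equal nat nat
  | Neg form
  | Conj form form
  | Forall nat form

locale membership =
  fixes mem :: "'a \<Rightarrow> 'a \<Rightarrow> bool"  (infix "\<^bold>\<in>" 50)
begin

primrec sat :: "(nat \<Rightarrow> 'a) \<Rightarrow> form \<Rightarrow> bool" where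
  "sat \<rho> (Mem i j) \<longleftrightarrow> \<rho> i \<^bold>\<in> \<rho> j"
| "sat \<rho> (Equal i j) \<longleftrightarrow> \<rho> i = \<rho> j"
| "sat \<rho> (Neg \<phi>) \<longleftrightarrow> \<not> sat \<rho> \<phi>"
| "sat \<rho> (Conj \<phi> \<psi>) \<longleftrightarrow> sat \<rho> \<phi> \<and> sat \<rho> \<psi>"
| "sat \<rho> (Forall i \<phi>) \<longleftrightarrow> (\<forall>a. sat (\<rho>(i := a)) \<phi>)"

definition is_empty :: "'a \<Rightarrow> bool" where
  "is_empty x \<longleftrightarrow> (\<forall>z. \<not> z \<^bold>\<in> x)"

definition subset_of :: "'a \<Rightarrow> 'a \<Rightarrow> bool"  (infix "\<^bold>\<subseteq>" 50) where
  "x \<^bold>\<subseteq> y \<longleftrightarrow> (\<forall>z. z \<^bold>\<in> x \<longrightarrow> z \<^bold>\<in> y)"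

definition is_union :: "'a \<Rightarrow> 'a \<Rightarrow> bool" where
  "is_union u x \<longleftrightarrow> (\<forall>z. z \<^bold>\<in> u \<longleftrightarrow> (\<exists>y. y \<^bold>\<in> x \<and> z \<^bold>\<in> y))"

definition is_upair :: "'a \<Rightarrow> 'a \<Rightarrow> 'a \<Rightarrow> bool" where
  "is_upair p a b \<longleftrightarrow> (\<forall>z. z \<^bold>\<in> p \<longleftrightarrow> z = a \<or> z = b)"

text \<open>Kuratowski pairs.\<close>

definition is_opair :: "'a \<Rightarrow> 'a \<Rightarrow> 'a \<Rightarrow> bool" where
  "is_opair p a b \<longleftrightarrow> (\<exists>s t. is_upair s a a \<and> is_upair t a b \<and> is_upair p s t)"

definition maps_to :: "'a \<Rightarrow> 'a \<Rightarrow> 'a \<Rightarrow> bool" where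
  "maps_to f a b \<longleftrightarrow> (\<exists>p. is_opair p a b \<and> p \<^bold>\<in> f)"

definition is_function :: "'a \<Rightarrow> 'a \<Rightarrow> 'a \<Rightarrow> bool" where
  "is_function f A B \<longleftrightarrow>
     (\<forall>p. p \<^bold>\<in> f \<longrightarrow> (\<exists>a b. a \<^bold>\<in> A \<and> b \<^bold>\<in> B \<and> is_opair p a b)) \<and>
     (\<forall>a. a \<^bold>\<in> A \<longrightarrow> (\<exists>!b. maps_to f a b))"

definition is_bijection :: "'a \<Rightarrow> 'a \<Rightarrow> 'a \<Rightarrow> bool" where
  "is_bijection f A B \<longleftrightarrow>
     is_function f A B \<and> (\<forall>b. b \<^bold>\<in> B \<longrightarrow> (\<exists>!a. maps_to f a b))"

definition equipollent :: "'a \<Rightarrow> 'a \<Rightarrow> bool" where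
  "equipollent A B \<longleftrightarrow> (\<exists>f. is_bijection f A B)"

definition is_succ :: "'a \<Rightarrow> 'a \<Rightarrow> bool" where
  "is_succ y x \<longleftrightarrow> (\<forall>z. z \<^bold>\<in> y \<longleftrightarrow> z \<^bold>\<in> x \<or> z = x)"

definition is_inductive :: "'a \<Rightarrow> bool" where
  "is_inductive I \<longleftrightarrow>
     (\<exists>e. is_empty e \<and> e \<^bold>\<in> I) \<and>
     (\<forall>x. x \<^bold>\<in> I \<longrightarrow> (\<exists>y. is_succ y x \<and> y \<^bold>\<in> I))"

text \<open>
  Membership in the model's own \<open>\<omega>\<close>, the least inductive set; it may contain nonstandard
  elements, so finiteness below is not finiteness in the sense of HOL.
\<close>

definition is_natural :: "'a \<Rightarrow> bool" where
  "is_natural k \<longleftrightarrow> (\<forall>I. is_inductive I \<longrightarrow> k \<^bold>\<in> I)"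

definition is_finite :: "'a \<Rightarrow> bool" where
  "is_finite x \<longleftrightarrow> (\<exists>k. is_natural k \<and> equipollent x k)"

abbreviation is_infinite :: "'a \<Rightarrow> bool" where
  "is_infinite x \<equiv> \<not> is_finite x"

text \<open>\<open>is_numeral n k\<close>: \<open>k\<close> is the von Neumann numeral of the standard number \<open>n\<close>.\<close>

primrec is_numeral :: "nat \<Rightarrow> 'a \<Rightarrow> bool" where
  "is_numeral 0 k \<longleftrightarrow> is_empty k"
| "is_numeral (Suc n) k \<longleftrightarrow> (\<exists>j. is_numeral n j \<and> is_succ k j)"

definition has_card :: "nat \<Rightarrow> 'a \<Rightarrow> bool" where
  "has_card n x \<longleftrightarrow> (\<exists>k. is_numeral n k \<and> equipollent x k)"

definition finite_card_gt :: "nat \<Rightarrow> 'a \<Rightarrow> bool" where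
  "finite_card_gt n x \<longleftrightarrow>
     (\<exists>k. is_natural k \<and> equipollent x k \<and> (\<exists>j. is_numeral n j \<and> j \<^bold>\<in> k))"

text \<open>\<open>d = [x]\<^sup>n\<close> and \<open>d = [x]\<^bsup>>n\<^esup>\<close>.\<close>

definition is_subsets_card :: "'a \<Rightarrow> nat \<Rightarrow> 'a \<Rightarrow> bool" where
  "is_subsets_card d n x \<longleftrightarrow> (\<forall>z. z \<^bold>\<in> d \<longleftrightarrow> z \<^bold>\<subseteq> x \<and> has_card n z)"

definition is_finite_subsets_gt :: "'a \<Rightarrow> nat \<Rightarrow> 'a \<Rightarrow> bool" where
  "is_finite_subsets_gt d n x \<longleftrightarrow> (\<forall>z. z \<^bold>\<in> d \<longleftrightarrow> z \<^bold>\<subseteq> x \<and> finite_card_gt n z)"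

definition nRC_fin :: "nat \<Rightarrow> bool" where
  "nRC_fin n \<longleftrightarrow>
     (\<forall>x. is_infinite x \<longrightarrow>
        (\<exists>y. is_infinite y \<and> y \<^bold>\<subseteq> x \<and>
           (\<exists>D R f. is_finite_subsets_gt D n y \<and> is_subsets_card R n y \<and> is_function f D R \<and>
              (\<forall>z w. z \<^bold>\<in> D \<and> maps_to f z w \<longrightarrow> w \<^bold>\<subseteq> z))))"

definition C_minus :: "nat \<Rightarrow> bool" where
  "C_minus n \<longleftrightarrow>
     (\<forall>F. is_infinite F \<and> (\<forall>A. A \<^bold>\<in> F \<longrightarrow> \<not> is_empty A \<and> has_card n A) \<longrightarrow>
        (\<exists>G. is_infinite G \<and> G \<^bold>\<subseteq> F \<and>
           (\<exists>U f. is_union U G \<and> is_function f G U \<and>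
              (\<forall>A a. A \<^bold>\<in> G \<and> maps_to f A a \<longrightarrow> a \<^bold>\<in> A))))"

end

text \<open>
  In the two schemas the valuation \<open>\<rho>\<close> supplies the parameters of \<open>\<phi>\<close>.  The sets \<open>x\<close>
  and \<open>y\<close> are not named by variables of \<open>\<phi>\<close>, so no freshness condition is needed.
\<close>

locale ZF = membership +
  assumes extensionality: "\<forall>x y. (\<forall>z. z \<^bold>\<in> x \<longleftrightarrow> z \<^bold>\<in> y) \<longrightarrow> x = y"
    and foundation: "\<forall>x. \<not> is_empty x \<longrightarrow> (\<exists>y. y \<^bold>\<in> x \<and> \<not> (\<exists>z. z \<^bold>\<in> x \<and> z \<^bold>\<in> y))"
    and pairing: "\<forall>a b. \<exists>p. is_upair p a b"
    and union: "\<forall>x. \<exists>u. is_union u x"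
    and power_set: "\<forall>x. \<exists>p. \<forall>z. z \<^bold>\<in> p \<longleftrightarrow> z \<^bold>\<subseteq> x"
    and infinity: "\<exists>I. is_inductive I"
    and separation:
      "\<forall>\<phi> \<rho> x. \<exists>y. \<forall>z. z \<^bold>\<in> y \<longleftrightarrow> z \<^bold>\<in> x \<and> sat (\<rho>(0 := z)) \<phi>"
    and replacement:
      "\<forall>\<phi> \<rho> x. (\<forall>a. a \<^bold>\<in> x \<longrightarrow> (\<exists>!b. sat (\<rho>(0 := a, 1 := b)) \<phi>)) \<longrightarrow>
         (\<exists>y. \<forall>b. b \<^bold>\<in> y \<longleftrightarrow> (\<exists>a. a \<^bold>\<in> x \<and> sat (\<rho>(0 := a, 1 := b)) \<phi>))"

end

(* Work with the disjoint sum of the triples; after discarding finitely many triples (or else a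
   choice is visible at once) the Ramsey choice function f is defined on all finite unions of triples.
   As 4 is not a multiple of 3, the four points chosen from a union of at least two triples
   split some triple, i.e. contain some but not all of its points, and a split triple has a
   distinguished point.  Suppose that only finitely many triples can be split uniformly.  For a
   triple A let N A be the finite set of those B that f splits in the union of A and B; for A and B
   distinct, A is in N B or B is in N A.  Only finitely many triples have N of a given size.
   If infinitely many A share this size with another triple, f applied to the union of each size
   class splits infinitely many triples.  Otherwise the remaining triples are well-ordered by size,
   and A is split by its union with the first such B that has A in N B. *)
theory Submission
  imports Defs
begin

section \<open>Definability\<close>

primrec rename :: "(nat \<Rightarrow> nat) \<Rightarrow> form \<Rightarrow> form" where
  "rename g (Mem i j) = Mem (g i) (g j)"
| "rename g (Equal i j) = Equal (g i) (g j)"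
| "rename g (Neg \<phi>) = Neg (rename g \<phi>)"
| "rename g (Conj \<phi> \<psi>) = Conj (rename g \<phi>) (rename g \<psi>)"
| "rename g (Forall i \<phi>) = Forall (g i) (rename g \<phi>)"

definition plug :: "nat \<Rightarrow> (nat \<Rightarrow> 'a) \<Rightarrow> (nat \<Rightarrow> 'a) \<Rightarrow> nat \<Rightarrow> 'a" where
  "plug k \<sigma> \<rho> = (\<lambda>i. if i < k then \<sigma> i else \<rho> (i - k))"

text \<open>The language has no function symbols, so variables and parameters are the only terms
  that can stand in an argument place.\<close>

definition var_or_const :: "((nat \<Rightarrow> 'a) \<Rightarrow> 'a) \<Rightarrow> bool" where
  "var_or_const t \<longleftrightarrow> (\<exists>i. t = (\<lambda>\<rho>. \<rho> i)) \<or> (\<exists>c. t = (\<lambda>\<rho>. c))"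

named_theorems definable_intros

lemma var_or_const_var [definable_intros]: "var_or_const (\<lambda>\<rho>. \<rho> i)"
  by (auto simp: var_or_const_def)

lemma var_or_const_const [definable_intros]: "var_or_const (\<lambda>\<rho>. c)"
  by (auto simp: var_or_const_def)

text \<open>Under a quantifier the outer environment is seen one index further up; this rule carries
  an unspecified term across it.\<close>

lemma var_or_const_shift: "var_or_const t \<Longrightarrow> var_or_const (\<lambda>\<rho>. t (\<lambda>i. \<rho> (Suc i)))"
  by (auto simp: var_or_const_def)

context membership
begin

text \<open>Bound variables are renamed together with free ones, so injectivity is what rules out
  capture.\<close>

lemma sat_rename: "inj g \<Longrightarrow> sat \<rho> (rename g \<phi>) \<longleftrightarrow> sat (\<lambda>i. \<rho> (g i)) \<phi>"
proof (induction \<phi> arbitrary: \<rho>)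
  case (Forall i \<phi>)
  have "(\<lambda>j. (\<rho>(g i := a)) (g j)) = (\<lambda>j. \<rho> (g j))(i := a)" for a
    using Forall.prems by (auto simp: fun_eq_iff inj_eq)
  with Forall show ?case by simp
qed auto

text \<open>Only finitely many variables matter, which leaves room for a quantified variable of
  large index.\<close>

lemma sat_coincidence:
  "\<exists>m. \<forall>\<rho> \<rho>'. (\<forall>i<m. \<rho> i = \<rho>' i) \<longrightarrow> sat \<rho> \<phi> = sat \<rho>' \<phi>"
proof (induction \<phi>)
  case (Mem i j)
  show ?case by (rule exI[of _ "Suc (max i j)"]) auto
next
  case (Equal i j)
  show ?case by (rule exI[of _ "Suc (max i j)"]) auto
next
  case (Neg \<phi>)
  then show ?case by simp
next
  case (Conj \<phi> \<psi>)
  then obtain m n where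
    m: "\<forall>\<rho> \<rho>'. (\<forall>i<m. \<rho> i = \<rho>' i) \<longrightarrow> sat \<rho> \<phi> = sat \<rho>' \<phi>" and
    n: "\<forall>\<rho> \<rho>'. (\<forall>i<n. \<rho> i = \<rho>' i) \<longrightarrow> sat \<rho> \<psi> = sat \<rho>' \<psi>" by blast
  show ?case
  proof (intro exI[of _ "max m n"] allI impI)
    fix \<rho> \<rho>' :: "nat \<Rightarrow> 'a"
    assume "\<forall>i<max m n. \<rho> i = \<rho>' i"
    then have "sat \<rho> \<phi> = sat \<rho>' \<phi>" "sat \<rho> \<psi> = sat \<rho>' \<psi>" using m n by simp_all
    then show "sat \<rho> (Conj \<phi> \<psi>) = sat \<rho>' (Conj \<phi> \<psi>)" by simp
  qed
next
  case (Forall j \<phi>)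
  then obtain m where
    m: "\<And>\<rho> \<rho>'. (\<forall>i<m. \<rho> i = \<rho>' i) \<Longrightarrow> sat \<rho> \<phi> = sat \<rho>' \<phi>" by blast
  show ?case
  proof (intro exI[of _ m] allI impI)
    fix \<rho> \<rho>' :: "nat \<Rightarrow> 'a"
    assume "\<forall>i<m. \<rho> i = \<rho>' i"
    then have "sat (\<rho>(j := a)) \<phi> = sat (\<rho>'(j := a)) \<phi>" for a by (intro m) simp
    then show "sat \<rho> (Forall j \<phi>) = sat \<rho>' (Forall j \<phi>)" by simp
  qed
qed

text \<open>A predicate on environments is definable if a formula expresses it, with the elements
  \<open>\<sigma> 0, \<dots>, \<sigma> (k - 1)\<close> of the model as parameters.  The rules below have the quantified variable
  at index \<open>0\<close> and the others shifted, as in de Bruijn's notation, so that definability of a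
  predicate can be proved by resolution along its syntax.\<close>

definition definable :: "((nat \<Rightarrow> 'a) \<Rightarrow> bool) \<Rightarrow> bool" where
  "definable P \<longleftrightarrow> (\<exists>\<phi> k \<sigma>. \<forall>\<rho>. P \<rho> \<longleftrightarrow> sat (plug k \<sigma> \<rho>) \<phi>)"

section \<open>Closure of the definable predicates under logical operations\<close>

lemma definableI: "(\<And>\<rho>. P \<rho> \<longleftrightarrow> sat (plug k \<sigma> \<rho>) \<phi>) \<Longrightarrow> definable P"
  by (auto simp: definable_def)

lemma definable_atom:
  assumes "var_or_const t" "var_or_const s"
  obtains k \<sigma> i j where "\<And>\<rho>. t \<rho> = plug k \<sigma> \<rho> i" "\<And>\<rho>. s \<rho> = plug k \<sigma> \<rho> j"
proof -
  \<comment> \<open>Two parameter slots serve both terms: slot 0 for a constant \<open>t\<close>,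
    slot 1 for a constant \<open>s\<close>; variables move up by 2. Each claim leaves the other slot
    arbitrary, so that the two can be merged.\<close>
  have "\<exists>i c. \<forall>d \<rho>. t \<rho> = plug 2 (case_nat c d) \<rho> i"
  proof -
    consider i where "t = (\<lambda>\<rho>. \<rho> i)" | c where "t = (\<lambda>\<rho>. c)"
      using assms(1) by (auto simp: var_or_const_def)
    then show ?thesis
    proof cases
      case 1
      then show ?thesis by (intro exI[of _ "i + 2"]) (auto simp: plug_def)
    next
      case 2
      then show ?thesis by (intro exI[of _ 0] exI[of _ c]) (auto simp: plug_def)
    qed
  qed
  moreover have "\<exists>j d. \<forall>c \<rho>. s \<rho> = plug 2 (case_nat c (\<lambda>_. d)) \<rho> j"
  proof -
    consider i where "s = (\<lambda>\<rho>. \<rho> i)" | c where "s = (\<lambda>\<rho>. c)"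
      using assms(2) by (auto simp: var_or_const_def)
    then show ?thesis
    proof cases
      case 1
      then show ?thesis by (intro exI[of _ "i + 2"]) (auto simp: plug_def)
    next
      case 2
      then show ?thesis by (intro exI[of _ 1] exI[of _ c]) (auto simp: plug_def)
    qed
  qed
  ultimately show ?thesis using that by blast
qed

lemma definable_mem [definable_intros]:
  assumes "var_or_const t" "var_or_const s"
  shows "definable (\<lambda>\<rho>. t \<rho> \<^bold>\<in> s \<rho>)"
proof -
  obtain k \<sigma> i j where "\<And>\<rho>. t \<rho> = plug k \<sigma> \<rho> i" "\<And>\<rho>. s \<rho> = plug k \<sigma> \<rho> j"
    using definable_atom[OF assms] by blast
  then show ?thesis by (intro definableI[of _ k \<sigma> "Mem i j"]) simp
qed

lemma definable_eq [definable_intros]: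
  assumes "var_or_const t" "var_or_const s"
  shows "definable (\<lambda>\<rho>. t \<rho> = s \<rho>)"
proof -
  obtain k \<sigma> i j where "\<And>\<rho>. t \<rho> = plug k \<sigma> \<rho> i" "\<And>\<rho>. s \<rho> = plug k \<sigma> \<rho> j"
    using definable_atom[OF assms] by blast
  then show ?thesis by (intro definableI[of _ k \<sigma> "Equal i j"]) simp
qed

lemma definable_not [definable_intros]: "definable P \<Longrightarrow> definable (\<lambda>\<rho>. \<not> P \<rho>)"
  unfolding definable_def by (elim exE, rename_tac \<phi> k \<sigma>, rule_tac x = "Neg \<phi>" in exI) auto

lemma definable_conj [definable_intros]:
  assumes "definable P" "definable Q"
  shows "definable (\<lambda>\<rho>. P \<rho> \<and> Q \<rho>)"
proof -
  obtain \<phi> k \<sigma> where P: "\<And>\<rho>. P \<rho> \<longleftrightarrow> sat (plug k \<sigma> \<rho>) \<phi>"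
    using assms(1) unfolding definable_def by blast
  obtain \<psi> l \<tau> where Q: "\<And>\<rho>. Q \<rho> \<longleftrightarrow> sat (plug l \<tau> \<rho>) \<psi>"
    using assms(2) unfolding definable_def by blast
  \<comment> \<open>The parameter lists are concatenated: \<open>?g\<close> makes the variables of
    \<open>\<phi>\<close> skip the \<open>l\<close> new parameters, and \<open>?h\<close> moves
    everything in \<open>\<psi>\<close> past the first \<open>k\<close>.\<close>
  let ?\<upsilon> = "\<lambda>i. if i < k then \<sigma> i else \<tau> (i - k)"
  let ?g = "\<lambda>i. if i < k then i else i + l" and ?h = "\<lambda>i. i + k"
  have g: "inj ?g" and h: "inj ?h" by (auto simp: inj_def)
  have "(\<lambda>i. plug (k + l) ?\<upsilon> \<rho> (?g i)) = plug k \<sigma> \<rho>" for \<rho>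
    by (auto simp: plug_def fun_eq_iff)
  moreover have "(\<lambda>i. plug (k + l) ?\<upsilon> \<rho> (?h i)) = plug l \<tau> \<rho>" for \<rho>
    by (auto simp: plug_def fun_eq_iff)
  ultimately show ?thesis
    by (intro definableI[of _ "k + l" ?\<upsilon> "Conj (rename ?g \<phi>) (rename ?h \<psi>)"])
      (simp add: sat_rename[OF g] sat_rename[OF h] P Q)
qed

lemma definable_disj [definable_intros]:
  assumes "definable P" "definable Q"
  shows "definable (\<lambda>\<rho>. P \<rho> \<or> Q \<rho>)"
  using definable_not[OF definable_conj[OF definable_not[OF assms(1)] definable_not[OF assms(2)]]]
  by simp

lemma definable_imp [definable_intros]:
  assumes "definable P" "definable Q"
  shows "definable (\<lambda>\<rho>. P \<rho> \<longrightarrow> Q \<rho>)"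
  using definable_disj[OF definable_not[OF assms(1)] assms(2)] by (simp only: imp_conv_disj)

lemma definable_iff [definable_intros]:
  assumes "definable P" "definable Q"
  shows "definable (\<lambda>\<rho>. P \<rho> \<longleftrightarrow> Q \<rho>)"
  unfolding iff_conv_conj_imp by (intro definable_conj definable_imp assms)

lemma definable_all [definable_intros]:
  assumes "definable (\<lambda>\<rho>. P (\<rho> 0) (\<lambda>i. \<rho> (Suc i)))"
  shows "definable (\<lambda>\<rho>. \<forall>a. P a \<rho>)"
proof -
  obtain \<phi> k \<sigma> where P: "\<And>\<rho>. P (\<rho> 0) (\<lambda>i. \<rho> (Suc i)) \<longleftrightarrow> sat (plug k \<sigma> \<rho>) \<phi>"
    using assms unfolding definable_def by blast
  obtain m where m: "\<And>\<rho> \<rho>'. (\<forall>i<m. \<rho> i = \<rho>' i) \<Longrightarrow> sat \<rho> \<phi> = sat \<rho>' \<phi>"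
    using sat_coincidence by blast
  \<comment> \<open>In \<open>\<phi>\<close> the quantified variable sits at index \<open>k\<close>,
    just after the parameters. It is moved to \<open>M\<close>, and the indices in between slide
    down by one to close the gap. Indices above \<open>M\<close> would be read wrongly, but they are
    irrelevant because \<open>m \<le> M\<close>.\<close>
  define M where "M = max m (Suc k)"
  define g where "g i = (if i < k then i else if i = k then M else if i \<le> M then i - 1 else i)" for i
  have "k < M" by (simp add: M_def)
  then have g: "inj g" by (auto simp: inj_def g_def split: if_splits)
  have "P a \<rho> \<longleftrightarrow> sat ((plug k \<sigma> \<rho>)(M := a)) (rename g \<phi>)" for a \<rho>
  proof -
    have "P a \<rho> \<longleftrightarrow> sat (plug k \<sigma> (case_nat a \<rho>)) \<phi>" by (simp flip: P)
    also have "\<dots> \<longleftrightarrow> sat (\<lambda>i. ((plug k \<sigma> \<rho>)(M := a)) (g i)) \<phi>"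
    proof (intro m allI impI)
      fix i assume "i < m"
      then have "i \<le> M" by (simp add: M_def)
      consider "i < k" | "i = k" | n where "i = Suc (n + k)"
        by (metis add_Suc add.commute less_imp_Suc_add linorder_neqE_nat)
      then show "plug k \<sigma> (case_nat a \<rho>) i = ((plug k \<sigma> \<rho>)(M := a)) (g i)"
        by cases (use \<open>k < M\<close> \<open>i \<le> M\<close> in \<open>auto simp: plug_def g_def Suc_diff_le\<close>)
    qed
    finally show ?thesis by (simp add: sat_rename[OF g])
  qed
  then show ?thesis by (intro definableI[of _ k \<sigma> "Forall M (rename g \<phi>)"]) simp
qed

lemma definable_ex [definable_intros]:
  assumes "definable (\<lambda>\<rho>. P (\<rho> 0) (\<lambda>i. \<rho> (Suc i)))"
  shows "definable (\<lambda>\<rho>. \<exists>a. P a \<rho>)"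
  using definable_not[OF definable_all[of "\<lambda>a \<rho>. \<not> P a \<rho>", OF definable_not[OF assms]]] by simp

text \<open>Unfolding unique existence puts the predicate under one quantifier and again under two,
  hence the two premises.\<close>

lemma definable_ex1 [definable_intros]:
  assumes "definable (\<lambda>\<rho>. P (\<rho> 0) (\<lambda>i. \<rho> (Suc i)))"
    and "definable (\<lambda>\<rho>. P (\<rho> 0) (\<lambda>i. \<rho> (Suc (Suc i))))"
  shows "definable (\<lambda>\<rho>. \<exists>!a. P a \<rho>)"
  unfolding Ex1_def by (intro definable_intros assms)

section \<open>Definability of the set-theoretic notions\<close>

lemma definable_empty [definable_intros]:
  assumes "var_or_const t" shows "definable (\<lambda>\<rho>. is_empty (t \<rho>))"
  unfolding is_empty_def by (rule definable_intros assms var_or_const_shift)+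

lemma definable_subset [definable_intros]:
  assumes "var_or_const t" "var_or_const s" shows "definable (\<lambda>\<rho>. t \<rho> \<^bold>\<subseteq> s \<rho>)"
  unfolding subset_of_def by (rule definable_intros assms var_or_const_shift)+

lemma definable_upair [definable_intros]:
  assumes "var_or_const t" "var_or_const s" "var_or_const u"
  shows "definable (\<lambda>\<rho>. is_upair (t \<rho>) (s \<rho>) (u \<rho>))"
  unfolding is_upair_def by (rule definable_intros assms var_or_const_shift)+

lemma definable_opair [definable_intros]:
  assumes "var_or_const t" "var_or_const s" "var_or_const u"
  shows "definable (\<lambda>\<rho>. is_opair (t \<rho>) (s \<rho>) (u \<rho>))"
  unfolding is_opair_def by (rule definable_intros assms var_or_const_shift)+

lemma definable_maps_to [definable_intros]:
  assumes "var_or_const t" "var_or_const s" "var_or_const u"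
  shows "definable (\<lambda>\<rho>. maps_to (t \<rho>) (s \<rho>) (u \<rho>))"
  unfolding maps_to_def by (rule definable_intros assms var_or_const_shift)+

lemma definable_function [definable_intros]:
  assumes "var_or_const t" "var_or_const s" "var_or_const u"
  shows "definable (\<lambda>\<rho>. is_function (t \<rho>) (s \<rho>) (u \<rho>))"
  unfolding is_function_def by (rule definable_intros assms var_or_const_shift)+

lemma definable_bijection [definable_intros]:
  assumes "var_or_const t" "var_or_const s" "var_or_const u"
  shows "definable (\<lambda>\<rho>. is_bijection (t \<rho>) (s \<rho>) (u \<rho>))"
  unfolding is_bijection_def by (rule definable_intros assms var_or_const_shift)+

lemma definable_equipollent [definable_intros]:
  assumes "var_or_const t" "var_or_const s"
  shows "definable (\<lambda>\<rho>. equipollent (t \<rho>) (s \<rho>))"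
  unfolding equipollent_def by (rule definable_intros assms var_or_const_shift)+

lemma definable_succ [definable_intros]:
  assumes "var_or_const t" "var_or_const s"
  shows "definable (\<lambda>\<rho>. is_succ (t \<rho>) (s \<rho>))"
  unfolding is_succ_def by (rule definable_intros assms var_or_const_shift)+

lemma definable_inductive [definable_intros]:
  assumes "var_or_const t" shows "definable (\<lambda>\<rho>. is_inductive (t \<rho>))"
  unfolding is_inductive_def by (rule definable_intros assms var_or_const_shift)+

lemma definable_natural [definable_intros]:
  assumes "var_or_const t" shows "definable (\<lambda>\<rho>. is_natural (t \<rho>))"
  unfolding is_natural_def by (rule definable_intros assms var_or_const_shift)+

lemma definable_finite [definable_intros]:
  assumes "var_or_const t" shows "definable (\<lambda>\<rho>. is_finite (t \<rho>))"
  unfolding is_finite_def by (rule definable_intros assms var_or_const_shift)+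

section \<open>Definable relations, class bijections and finite covers\<close>

definition definable_rel :: "('a \<Rightarrow> 'a \<Rightarrow> bool) \<Rightarrow> bool" where
  "definable_rel R \<longleftrightarrow> (\<forall>i j. definable (\<lambda>\<rho>. R (\<rho> i) (\<rho> j)))"

lemma definable_relI: "(\<And>i j. definable (\<lambda>\<rho>. R (\<rho> i) (\<rho> j))) \<Longrightarrow> definable_rel R"
  by (simp add: definable_rel_def)

lemma definable_relD:
  assumes "definable_rel R" "var_or_const t" "var_or_const s"
  shows "definable (\<lambda>\<rho>. R (t \<rho>) (s \<rho>))"
proof -
  have R: "definable (\<lambda>\<rho>. R (\<rho> i) (\<rho> j))" for i j
    using assms(1) by (simp add: definable_rel_def)
  \<comment> \<open>Naming both terms by quantified variables reduces parameters to the case of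
    variables.\<close>
  have "definable (\<lambda>\<rho>. \<exists>a. a = t \<rho> \<and> (\<exists>b. b = s \<rho> \<and> R a b))"
    by (rule definable_intros R assms(2,3) var_or_const_shift)+
  then show ?thesis by simp
qed

text \<open>With a relation in place of a set of pairs, bijections can be modified by logical
  formulas alone.\<close>

definition bij_rel :: "('a \<Rightarrow> 'a \<Rightarrow> bool) \<Rightarrow> 'a \<Rightarrow> 'a \<Rightarrow> bool" where
  "bij_rel R A B \<longleftrightarrow> (\<forall>a b. R a b \<longrightarrow> a \<^bold>\<in> A \<and> b \<^bold>\<in> B) \<and>
     (\<forall>a. a \<^bold>\<in> A \<longrightarrow> (\<exists>!b. R a b)) \<and> (\<forall>b. b \<^bold>\<in> B \<longrightarrow> (\<exists>!a. R a b))"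

lemma bij_relI:
  assumes "\<And>a b. R a b \<Longrightarrow> a \<^bold>\<in> A \<and> b \<^bold>\<in> B"
    and "\<And>a. a \<^bold>\<in> A \<Longrightarrow> \<exists>b. R a b" "\<And>b. b \<^bold>\<in> B \<Longrightarrow> \<exists>a. R a b"
    and "\<And>a b c. R a b \<Longrightarrow> R a c \<Longrightarrow> b = c" "\<And>a b c. R a b \<Longrightarrow> R c b \<Longrightarrow> a = c"
  shows "bij_rel R A B"
  unfolding bij_rel_def using assms by blast

lemma bij_relD:
  assumes "bij_rel R A B"
  shows "R a b \<Longrightarrow> a \<^bold>\<in> A" "R a b \<Longrightarrow> b \<^bold>\<in> B"
    and "a \<^bold>\<in> A \<Longrightarrow> \<exists>b. R a b" "b \<^bold>\<in> B \<Longrightarrow> \<exists>a. R a b"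
    and "R a b \<Longrightarrow> R a c \<Longrightarrow> b = c" "R a b \<Longrightarrow> R c b \<Longrightarrow> a = c"
  using assms unfolding bij_rel_def by blast+

text \<open>Unlike finiteness of a set of the model, this is monotone in arbitrary predicates, so no
  definability condition is needed to pass to a smaller predicate.\<close>

definition covered :: "('a \<Rightarrow> bool) \<Rightarrow> bool" where
  "covered Q \<longleftrightarrow> (\<exists>s. is_finite s \<and> (\<forall>u. Q u \<longrightarrow> u \<^bold>\<in> s))"

lemma covered_mono: "covered Q \<Longrightarrow> (\<And>u. P u \<Longrightarrow> Q u) \<Longrightarrow> covered P"
  unfolding covered_def by blast

text \<open>\<open>t\<close> is one relation for all sets \<open>A\<close>, so a definable
  \<open>t\<close> is a uniform way of cutting all triples at once.\<close>

definition splits :: "('a \<Rightarrow> 'a \<Rightarrow> bool) \<Rightarrow> 'a \<Rightarrow> bool" where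
  "splits t A \<longleftrightarrow> (\<exists>a. a \<^bold>\<in> A \<and> t A a) \<and> (\<exists>a. a \<^bold>\<in> A \<and> \<not> t A a)"

lemma splits_cong: "(\<And>a. t A a \<longleftrightarrow> s A a) \<Longrightarrow> splits t A \<longleftrightarrow> splits s A"
  by (simp add: splits_def)

end

section \<open>Finite sets in a model of ZF\<close>

context ZF
begin

section \<open>Separation for definable predicates, elementary sets and pairs\<close>

lemma same_elements_eqI: "(\<And>z. z \<^bold>\<in> x \<longleftrightarrow> z \<^bold>\<in> y) \<Longrightarrow> x = y"
  using extensionality by blast

lemma separation_definable:
  assumes "definable (\<lambda>\<rho>. P (\<rho> 0))"
  obtains y where "\<And>z. z \<^bold>\<in> y \<longleftrightarrow> z \<^bold>\<in> x \<and> P z"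
proof -
  obtain \<phi> k \<sigma> where P: "\<And>\<rho>. P (\<rho> 0) \<longleftrightarrow> sat (plug k \<sigma> \<rho>) \<phi>"
    using assms unfolding definable_def by blast
  \<comment> \<open>The separation schema has the element at index 0, whereas \<open>plug\<close>
    has it at index \<open>k\<close>; \<open>g\<close> exchanges the two.\<close>
  define g where "g i = (if i = 0 then k else if i = k then 0 else i)" for i :: nat
  have g: "inj g" by (auto simp: inj_def g_def split: if_splits)
  \<comment> \<open>\<open>P\<close> looks at \<open>\<rho> 0\<close> only, so the other variables
    may hold \<open>undefined\<close>.\<close>
  define \<tau> where "\<tau> i = plug k \<sigma> (\<lambda>_. undefined) (g i)" for i
  have "P z \<longleftrightarrow> sat (\<tau>(0 := z)) (rename g \<phi>)" for z
  proof -
    have "(\<lambda>i. (\<tau>(0 := z)) (g i)) = plug k \<sigma> ((\<lambda>_. undefined)(0 := z))"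
      by (auto simp: fun_eq_iff \<tau>_def g_def plug_def)
    then show ?thesis using P[of "(\<lambda>_. undefined)(0 := z)"] by (simp add: sat_rename[OF g])
  qed
  then show ?thesis using separation[rule_format, of x \<tau> "rename g \<phi>"] that by auto
qed

definition emp :: 'a where
  "emp = (THE e. is_empty e)"

lemma is_empty_iff: "is_empty x \<longleftrightarrow> x = emp"
proof -
  \<comment> \<open>An unsatisfiable predicate separates the empty set.\<close>
  have "definable (\<lambda>\<rho>. \<not> \<rho> 0 = \<rho> 0)" by (intro definable_intros)
  from separation_definable[OF this] obtain e where "is_empty e"
    unfolding is_empty_def by metis
  moreover have "y = z" if "is_empty y" "is_empty z" for y z
    using that by (intro same_elements_eqI) (auto simp: is_empty_def)
  ultimately show ?thesis unfolding emp_def by (metis theI)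
qed

lemma not_mem_emp [simp]: "\<not> z \<^bold>\<in> emp"
  using is_empty_iff[of emp] by (auto simp: is_empty_def)

lemma ex_mem: "x \<noteq> emp \<Longrightarrow> \<exists>z. z \<^bold>\<in> x"
  using is_empty_iff[of x] by (auto simp: is_empty_def)

definition ins :: "'a \<Rightarrow> 'a \<Rightarrow> 'a" where
  "ins a x = (THE u. \<forall>z. z \<^bold>\<in> u \<longleftrightarrow> z = a \<or> z \<^bold>\<in> x)"

lemma mem_ins [simp]: "z \<^bold>\<in> ins a x \<longleftrightarrow> z = a \<or> z \<^bold>\<in> x"
proof -
  obtain s where s: "is_upair s a a" using pairing by blast
  obtain t where t: "is_upair t s x" using pairing by blast
  obtain u where u: "is_union u t" using union by blast
  have "\<forall>z. z \<^bold>\<in> u \<longleftrightarrow> z = a \<or> z \<^bold>\<in> x"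
    using s t u unfolding is_upair_def is_union_def by metis
  moreover from this have "v = u" if "\<forall>z. z \<^bold>\<in> v \<longleftrightarrow> z = a \<or> z \<^bold>\<in> x" for v
    using that by (intro same_elements_eqI) simp
  ultimately have "\<forall>z. z \<^bold>\<in> ins a x \<longleftrightarrow> z = a \<or> z \<^bold>\<in> x"
    unfolding ins_def by (rule theI)
  then show ?thesis by blast
qed

lemma is_succ_iff: "is_succ y x \<longleftrightarrow> y = ins x x"
  unfolding is_succ_def by (auto intro: same_elements_eqI)

lemma is_upair_iff: "is_upair p a b \<longleftrightarrow> p = ins a (ins b emp)"
  unfolding is_upair_def by (auto intro: same_elements_eqI)

definition pr :: "'a \<Rightarrow> 'a \<Rightarrow> 'a" where
  "pr a b = ins (ins a (ins a emp)) (ins (ins a (ins b emp)) emp)"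

lemma is_opair_iff: "is_opair p a b \<longleftrightarrow> p = pr a b"
  by (auto simp: is_opair_def is_upair_iff pr_def)

lemma pr_eq_iff [simp]: "pr a b = pr c d \<longleftrightarrow> a = c \<and> b = d"
proof
  assume eq: "pr a b = pr c d"
  have single: "ins u (ins v emp) = ins w (ins w emp) \<longleftrightarrow> u = w \<and> v = w" for u v w
    by (metis mem_ins not_mem_emp)
  have "z = ins a (ins a emp) \<or> z = ins a (ins b emp) \<longleftrightarrow>
      z = ins c (ins c emp) \<or> z = ins c (ins d emp)" for z
    using arg_cong[OF eq, of "\<lambda>p. z \<^bold>\<in> p"] by (simp add: pr_def)
  then have "a = c" "ins a (ins b emp) = ins c (ins d emp)" using single by metis+
  then show "a = c \<and> b = d" by (metis mem_ins not_mem_emp)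
qed simp

lemma maps_to_iff: "maps_to f a b \<longleftrightarrow> pr a b \<^bold>\<in> f"
  by (simp add: maps_to_def is_opair_iff)

text \<open>Kuratowski pairs are sets of subsets of the union of \<open>A\<close> and
  \<open>B\<close>, so they lie in its double power set.\<close>

lemma product_bound: "\<exists>c. \<forall>a b. a \<^bold>\<in> A \<longrightarrow> b \<^bold>\<in> B \<longrightarrow> pr a b \<^bold>\<in> c"
proof -
  obtain t where t: "is_upair t A B" using pairing by blast
  obtain u where u: "is_union u t" using union by blast
  obtain p where p: "\<And>z. z \<^bold>\<in> p \<longleftrightarrow> z \<^bold>\<subseteq> u" using power_set by blast
  obtain q where q: "\<And>z. z \<^bold>\<in> q \<longleftrightarrow> z \<^bold>\<subseteq> p" using power_set by blast
  have "pr a b \<^bold>\<in> q" if "a \<^bold>\<in> A" "b \<^bold>\<in> B" for a b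
  proof -
    have "a \<^bold>\<in> u" "b \<^bold>\<in> u" using that t u by (auto simp: is_upair_def is_union_def)
    then show ?thesis by (simp add: q p subset_of_def pr_def)
  qed
  then show ?thesis by blast
qed

lemma relation_set:
  assumes "definable_rel R"
  obtains r where "\<And>p. p \<^bold>\<in> r \<longleftrightarrow> (\<exists>a b. a \<^bold>\<in> A \<and> b \<^bold>\<in> B \<and> R a b \<and> p = pr a b)"
proof -
  obtain c where c: "\<And>a b. a \<^bold>\<in> A \<Longrightarrow> b \<^bold>\<in> B \<Longrightarrow> pr a b \<^bold>\<in> c" using product_bound by blast
  have "definable (\<lambda>\<rho>. \<exists>a b. a \<^bold>\<in> A \<and> b \<^bold>\<in> B \<and> R a b \<and> is_opair (\<rho> 0) a b)"
    by (intro definable_intros definable_relD[OF assms])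
  from separation_definable[OF this, of c] c that show ?thesis
    unfolding is_opair_iff by metis
qed

section \<open>Equipollence, and adding or deleting one point\<close>

text \<open>Evaluation of a function set is itself a definable relation; conversely, the graph of a
  definable relation between two sets is a set by separation.\<close>

lemma equipollent_iff: "equipollent A B \<longleftrightarrow> (\<exists>R. definable_rel R \<and> bij_rel R A B)"
proof
  assume "equipollent A B"
  then obtain f where f: "is_bijection f A B" by (auto simp: equipollent_def)
  have "definable_rel (maps_to f)" by (intro definable_relI definable_intros)
  moreover have "bij_rel (maps_to f) A B"
    unfolding bij_rel_def
  proof (intro conjI allI impI)
    fix a b assume "maps_to f a b"
    then obtain c d where "c \<^bold>\<in> A" "d \<^bold>\<in> B" "pr a b = pr c d"
      using f unfolding is_bijection_def is_function_def maps_to_iff is_opair_iff by blast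
    then show "a \<^bold>\<in> A" "b \<^bold>\<in> B" by simp_all
  qed (use f in \<open>simp_all add: is_bijection_def is_function_def\<close>)
  ultimately show "\<exists>R. definable_rel R \<and> bij_rel R A B" by blast
next
  assume "\<exists>R. definable_rel R \<and> bij_rel R A B"
  then obtain R where R: "definable_rel R" "bij_rel R A B" by blast
  obtain f where f: "\<And>p. p \<^bold>\<in> f \<longleftrightarrow> (\<exists>a b. a \<^bold>\<in> A \<and> b \<^bold>\<in> B \<and> R a b \<and> p = pr a b)"
    using relation_set[OF R(1)] by blast
  have maps: "maps_to f a b \<longleftrightarrow> R a b" for a b
    using R(2) by (auto simp: maps_to_iff f bij_rel_def)
  have "is_bijection f A B"
    unfolding is_bijection_def is_function_def maps
    using R(2) unfolding bij_rel_def is_opair_iff f by simp blast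
  then show "equipollent A B" by (auto simp: equipollent_def)
qed

lemma equipollentE:
  assumes "equipollent A B"
  obtains R where "definable_rel R" "bij_rel R A B"
  using assms by (auto simp: equipollent_iff)

lemma equipollent_emp [simp]: "equipollent X emp \<longleftrightarrow> X = emp"
proof
  assume "equipollent X emp"
  then show "X = emp" by (metis equipollentE bij_rel_def ex_mem not_mem_emp)
next
  assume "X = emp"
  moreover have "definable_rel (\<lambda>a b. \<not> a = a)" by (intro definable_relI definable_intros)
  moreover have "bij_rel (\<lambda>a b. \<not> a = a) emp emp" by (simp add: bij_rel_def)
  ultimately show "equipollent X emp" unfolding equipollent_iff by blast
qed

lemma equipollent_ex_mem:
  assumes "equipollent X k" "b \<^bold>\<in> k"
  shows "\<exists>a. a \<^bold>\<in> X"
proof -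
  obtain R where "bij_rel R X k" using assms(1) by (rule equipollentE)
  with assms(2) show ?thesis using bij_relD(1,4) by blast
qed

lemma emp_equipollentD: "equipollent emp k \<Longrightarrow> k = emp"
  using equipollent_ex_mem ex_mem not_mem_emp by blast

lemma equipollent_ins:
  assumes "equipollent X k" "\<not> a \<^bold>\<in> X" "\<not> b \<^bold>\<in> k"
  shows "equipollent (ins a X) (ins b k)"
proof -
  obtain R where R: "definable_rel R" "bij_rel R X k" using assms(1) by (rule equipollentE)
  let ?S = "\<lambda>u v. R u v \<or> u = a \<and> v = b"
  have "definable_rel ?S" by (intro definable_relI definable_intros definable_relD[OF R(1)])
  moreover note R' = bij_relD[OF R(2)]
  have "bij_rel ?S (ins a X) (ins b k)"
  proof (rule bij_relI, goal_cases)
    case (2 u)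
    then show ?case using R'(3)[of u] by (cases "u = a") auto
  next
    case (3 v)
    then show ?case using R'(4)[of v] by (cases "v = b") auto
  qed (use R' assms(2,3) in auto)
  ultimately show ?thesis unfolding equipollent_iff by blast
qed

definition del :: "'a \<Rightarrow> 'a \<Rightarrow> 'a" where
  "del a x = (THE u. \<forall>z. z \<^bold>\<in> u \<longleftrightarrow> z \<^bold>\<in> x \<and> z \<noteq> a)"

lemma mem_del [simp]: "z \<^bold>\<in> del a x \<longleftrightarrow> z \<^bold>\<in> x \<and> z \<noteq> a"
proof -
  have "definable (\<lambda>\<rho>. \<rho> 0 \<noteq> a)" by (intro definable_intros)
  then obtain u where u: "\<forall>z. z \<^bold>\<in> u \<longleftrightarrow> z \<^bold>\<in> x \<and> z \<noteq> a" by (rule separation_definable[of _ x]) blast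
  then have "v = u" if "\<forall>z. z \<^bold>\<in> v \<longleftrightarrow> z \<^bold>\<in> x \<and> z \<noteq> a" for v
    using that by (intro same_elements_eqI) simp
  with u have "\<forall>z. z \<^bold>\<in> del a x \<longleftrightarrow> z \<^bold>\<in> x \<and> z \<noteq> a"
    unfolding del_def by (rule theI)
  then show ?thesis by blast
qed

lemma ins_del: "a \<^bold>\<in> x \<Longrightarrow> ins a (del a x) = x"
  by (rule same_elements_eqI) auto

lemma equipollent_del:
  assumes "equipollent X (ins b k)" "\<not> b \<^bold>\<in> k" "a \<^bold>\<in> X"
  shows "equipollent (del a X) k"
proof -
  obtain R where R: "definable_rel R" "bij_rel R X (ins b k)" using assms(1) by (rule equipollentE)
  \<comment> \<open>The point that \<open>R\<close> sends to \<open>b\<close> is redirected to the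
    image of \<open>a\<close>. If \<open>a\<close> itself goes to \<open>b\<close>, the second
    alternative is vacuous.\<close>
  let ?S = "\<lambda>u v. u \<noteq> a \<and> v \<noteq> b \<and> (R u v \<or> R u b \<and> R a v)"
  have "definable_rel ?S"
    by (intro definable_relI definable_intros definable_relD[OF R(1)])
  moreover have "bij_rel ?S (del a X) k"
  proof -
    note R' = bij_relD[OF R(2), unfolded mem_ins]
    show ?thesis
    proof (rule bij_relI, goal_cases)
      case (1 u v)
      then have "u \<^bold>\<in> X" "v = b \<or> v \<^bold>\<in> k" using R'(1,2) by blast+
      with 1 show ?case by simp
    next
      case (2 u)
      then have u: "u \<^bold>\<in> X" "u \<noteq> a" by simp_all
      obtain v where v: "R u v" using R'(3)[OF u(1)] by blast
      obtain w where w: "R a w" using R'(3)[OF assms(3)] by blast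
      show ?case
      proof (cases "v = b")
        case True
        then have "w \<noteq> b" using R'(6) v w u(2) by blast
        with True u v w show ?thesis by blast
      qed (use u v in blast)
    next
      case (3 v)
      then have "v \<noteq> b" using assms(2) by blast
      obtain u where u: "R u v" using R'(4)[of v] 3 by blast
      obtain w where w: "R w b" using R'(4)[of b] by blast
      show ?case
      proof (cases "u = a")
        case True
        then have "w \<noteq> a" using R'(5) u w \<open>v \<noteq> b\<close> by blast
        with True u w \<open>v \<noteq> b\<close> show ?thesis by blast
      qed (use u \<open>v \<noteq> b\<close> in blast)
    next
      case (4 u v w)
      then show ?case using R'(5) by blast
    next
      case (5 u v w)
      then show ?case using R'(6) by blast
    qed
  qed
  ultimately show ?thesis unfolding equipollent_iff by blast
qed

section \<open>Natural numbers of the model\<close>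

text \<open>Foundation for the singleton of \<open>x\<close>. It makes \<open>k\<close> a new
  element of \<open>ins k k\<close>, as the counting lemmas require.\<close>

lemma mem_irrefl [simp]: "\<not> x \<^bold>\<in> x"
proof -
  have "\<not> is_empty (ins x emp)" by (auto simp: is_empty_def)
  then show ?thesis using foundation by (metis mem_ins not_mem_emp)
qed

lemma natural_emp [simp]: "is_natural emp"
  by (auto simp: is_natural_def is_inductive_def is_empty_iff)

lemma natural_succ: "is_natural k \<Longrightarrow> is_natural (ins k k)"
  by (auto simp: is_natural_def is_inductive_def is_succ_iff)

text \<open>The naturals with \<open>P\<close> inside some inductive set form an inductive set.
  Separation must produce it, hence the definability premise.\<close>

lemma natural_induct [consumes 1, case_names definable emp succ]:
  assumes "is_natural k" "definable (\<lambda>\<rho>. P (\<rho> 0))"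
    and "P emp" "\<And>k. is_natural k \<Longrightarrow> P k \<Longrightarrow> P (ins k k)"
  shows "P k"
proof -
  obtain I where I: "is_inductive I" using infinity by blast
  have "definable (\<lambda>\<rho>. is_natural (\<rho> 0) \<and> P (\<rho> 0))" by (intro definable_intros assms(2))
  then obtain J where J: "\<And>z. z \<^bold>\<in> J \<longleftrightarrow> z \<^bold>\<in> I \<and> is_natural z \<and> P z"
    by (rule separation_definable[of _ I]) blast
  have "is_inductive J"
    using I assms(3,4) natural_succ by (auto simp: is_inductive_def J is_empty_iff is_succ_iff)
  then show ?thesis using assms(1) by (auto simp: is_natural_def J)
qed

lemma natural_cases:
  assumes "is_natural k"
  obtains "k = emp" | j where "is_natural j" "k = ins j j"
proof -
  have "k = emp \<or> (\<exists>j. is_natural j \<and> is_succ k j)"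
    using assms
  proof (induction rule: natural_induct)
    case definable
    show ?case by (intro definable_intros)
  qed (auto simp: is_succ_iff)
  with that show ?thesis by (auto simp: is_succ_iff)
qed

lemma natural_mem:
  assumes "is_natural k" "j \<^bold>\<in> k"
  shows "is_natural j" "j \<^bold>\<subseteq> k"
proof -
  have "\<forall>j. j \<^bold>\<in> k \<longrightarrow> is_natural j \<and> j \<^bold>\<subseteq> k"
    using assms(1)
  proof (induction rule: natural_induct)
    case definable
    show ?case by (intro definable_intros)
  qed (auto simp: subset_of_def)
  with assms(2) show "is_natural j" "j \<^bold>\<subseteq> k" by auto
qed

lemma subset_of_antisym: "x \<^bold>\<subseteq> y \<Longrightarrow> y \<^bold>\<subseteq> x \<Longrightarrow> x = y"
  by (rule same_elements_eqI) (auto simp: subset_of_def)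

lemma natural_subset:
  assumes "is_natural k" "is_natural n" "n \<^bold>\<subseteq> k"
  shows "n = k \<or> n \<^bold>\<in> k"
proof -
  have "\<forall>n. is_natural n \<and> n \<^bold>\<subseteq> k \<longrightarrow> n = k \<or> n \<^bold>\<in> k"
    using assms(1)
  proof (induction rule: natural_induct)
    case definable
    show ?case by (intro definable_intros)
  next
    case emp
    show ?case by (metis ex_mem not_mem_emp subset_of_def)
  next
    case (succ k)
    show ?case
    proof (intro allI impI)
      fix n assume n: "is_natural n \<and> n \<^bold>\<subseteq> ins k k"
      show "n = ins k k \<or> n \<^bold>\<in> ins k k"
      proof (cases "k \<^bold>\<in> n")
        case True
        then have "k \<^bold>\<subseteq> n" using n natural_mem by blast
        with n True have "n = ins k k" by (intro subset_of_antisym) (auto simp: subset_of_def)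
        then show ?thesis ..
      next
        case False
        with n have "n \<^bold>\<subseteq> k" by (auto simp: subset_of_def)
        with succ n show ?thesis by auto
      qed
    qed
  qed
  with assms show ?thesis by blast
qed

text \<open>Without a least element, induction shows that every natural lies below all of
  \<open>K\<close>; for the successor of \<open>k\<close> this is absurd.\<close>

lemma natural_least:
  assumes "definable (\<lambda>\<rho>. K (\<rho> 0))" "K k" "\<And>k. K k \<Longrightarrow> is_natural k"
  shows "\<exists>m. K m \<and> (\<forall>j. K j \<longrightarrow> m \<^bold>\<subseteq> j)"
proof (rule ccontr)
  assume "\<not> ?thesis"
  then have none: "\<exists>j. K j \<and> \<not> m \<^bold>\<subseteq> j" if "K m" for m
    using that by blast
  have "\<forall>j. K j \<longrightarrow> n \<^bold>\<subseteq> j" if "is_natural n" for n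
    using that
  proof (induction rule: natural_induct)
    case definable
    show ?case by (intro definable_intros assms(1))
  next
    case emp
    show ?case by (simp add: subset_of_def)
  next
    case (succ n)
    show ?case
    proof (intro allI impI)
      fix j assume j: "K j"
      \<comment> \<open>By the induction hypothesis \<open>n = j\<close> would make \<open>j\<close>
        least.\<close>
      have "n \<noteq> j" using none[OF j] succ by blast
      then have "n \<^bold>\<in> j" using natural_subset[of j n] assms(3) j succ by blast
      with succ j show "ins n n \<^bold>\<subseteq> j" by (auto simp: subset_of_def)
    qed
  qed
  from this[OF natural_succ[OF assms(3)[OF assms(2)]]] assms(2) have "ins k k \<^bold>\<subseteq> k" by blast
  then show False by (auto simp: subset_of_def)
qed

lemma natural_linear:
  assumes "is_natural j" "is_natural k"
  shows "j \<^bold>\<in> k \<or> k \<^bold>\<subseteq> j"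
proof -
  \<comment> \<open>Comparability comes from the least element of the class consisting of
    \<open>j\<close> and \<open>k\<close>.\<close>
  have "definable (\<lambda>\<rho>. \<rho> 0 = j \<or> \<rho> 0 = k)" by (intro definable_intros)
  from natural_least[where K = "\<lambda>i. i = j \<or> i = k", OF this, of j] assms
  obtain m where "m = j \<or> m = k" "m \<^bold>\<subseteq> j" "m \<^bold>\<subseteq> k" by blast
  then show ?thesis using natural_subset[of k j] assms by (auto simp: subset_of_def)
qed

section \<open>Uniqueness of finite sizes and the pigeonhole principle\<close>

lemma equipollent_natural_unique:
  assumes "is_natural k" "is_natural j" "equipollent X k" "equipollent X j"
  shows "k = j"
proof -
  \<comment> \<open>The claim is generalised over \<open>X\<close> and \<open>j\<close> because
    deleting a point changes both.\<close>
  have "\<forall>X j. is_natural j \<and> equipollent X k \<and> equipollent X j \<longrightarrow> k = j"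
    using assms(1)
  proof (induction rule: natural_induct)
    case definable
    show ?case by (intro definable_intros)
  next
    case emp
    have "j = emp" if "is_natural j" "equipollent emp j" for j
      using that emp_equipollentD by blast
    then show ?case by auto
  next
    case (succ k)
    show ?case
    proof (intro allI impI)
      fix X j assume *: "is_natural j \<and> equipollent X (ins k k) \<and> equipollent X j"
      then obtain a where a: "a \<^bold>\<in> X" using equipollent_ex_mem mem_ins by blast
      with * have "j \<noteq> emp" by auto
      with * obtain i where i: "is_natural i" "j = ins i i" by (blast elim: natural_cases)
      have "equipollent (del a X) k" "equipollent (del a X) i"
        using * i a equipollent_del[OF _ mem_irrefl a] by simp_all
      with succ i show "ins k k = j" by blast
    qed
  qed
  with assms show ?thesis by blast
qed

text \<open>Deleting a common element from both sets lowers \<open>k\<close> by one and preserves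
  the inclusion.\<close>

lemma pigeonhole:
  assumes "is_natural k" "equipollent X k" "equipollent Y k" "X \<^bold>\<subseteq> Y"
  shows "X = Y"
proof -
  have "\<forall>X Y. equipollent X k \<and> equipollent Y k \<and> X \<^bold>\<subseteq> Y \<longrightarrow> X = Y"
    using assms(1)
  proof (induction rule: natural_induct)
    case definable
    show ?case by (intro definable_intros)
  next
    case emp
    show ?case by simp
  next
    case (succ k)
    show ?case
    proof (intro allI impI)
      fix X Y assume *: "equipollent X (ins k k) \<and> equipollent Y (ins k k) \<and> X \<^bold>\<subseteq> Y"
      then obtain a where a: "a \<^bold>\<in> X" using equipollent_ex_mem mem_ins by blast
      with * have "a \<^bold>\<in> Y" by (auto simp: subset_of_def)
      with a have "equipollent (del a X) k" "equipollent (del a Y) k"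
        using * equipollent_del[OF _ mem_irrefl] by blast+
      moreover have "del a X \<^bold>\<subseteq> del a Y" using * by (auto simp: subset_of_def)
      ultimately have "del a X = del a Y" using succ by blast
      then show "X = Y" using ins_del[OF \<open>a \<^bold>\<in> X\<close>] ins_del[OF \<open>a \<^bold>\<in> Y\<close>] by metis
    qed
  qed
  with assms show ?thesis by blast
qed

section \<open>Finite sets and covered predicates\<close>

lemma is_finite_emp [simp]: "is_finite emp"
  unfolding is_finite_def using natural_emp equipollent_emp by blast

lemma is_finite_ins:
  assumes "is_finite X"
  shows "is_finite (ins a X)"
proof (cases "a \<^bold>\<in> X")
  case True
  then have "ins a X = X" by (auto intro: same_elements_eqI)
  with assms show ?thesis by simp
next
  case False
  then show ?thesis
    using assms natural_succ equipollent_ins[OF _ False mem_irrefl] unfolding is_finite_def by blast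
qed

lemma is_finite_induct [consumes 1, case_names definable emp ins]:
  assumes "is_finite X" "definable (\<lambda>\<rho>. P (\<rho> 0))"
    and "P emp" "\<And>a X. P X \<Longrightarrow> P (ins a X)"
  shows "P X"
proof -
  obtain k where k: "is_natural k" "equipollent X k" using assms(1) by (auto simp: is_finite_def)
  from k(1) have "\<forall>X. equipollent X k \<longrightarrow> P X"
  proof (induction rule: natural_induct)
    case definable
    show ?case by (intro definable_intros assms(2))
  next
    case emp
    show ?case using assms(3) by simp
  next
    case (succ k)
    show ?case
    proof (intro allI impI)
      fix X assume *: "equipollent X (ins k k)"
      then obtain a where a: "a \<^bold>\<in> X" using equipollent_ex_mem mem_ins by blast
      then have "P (del a X)" using equipollent_del[OF * mem_irrefl] succ by blast
      then show "P X" using assms(4)[of "del a X" a] ins_del[OF a] by simp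
    qed
  qed
  with k show ?thesis by blast
qed

lemma is_finite_subset:
  assumes "is_finite X" "Y \<^bold>\<subseteq> X"
  shows "is_finite Y"
proof -
  from assms(1) have "\<forall>Y. Y \<^bold>\<subseteq> X \<longrightarrow> is_finite Y"
  proof (induction rule: is_finite_induct)
    case definable
    show ?case by (intro definable_intros)
  next
    case emp
    have "Y = emp" if "Y \<^bold>\<subseteq> emp" for Y
      using that by (auto simp: subset_of_def intro: same_elements_eqI)
    then show ?case by (metis is_finite_emp)
  next
    case (ins a X)
    show ?case
    proof (intro allI impI)
      fix Y assume Y: "Y \<^bold>\<subseteq> ins a X"
      then have "del a Y \<^bold>\<subseteq> X" by (auto simp: subset_of_def)
      then have "is_finite (del a Y)" using ins by blast
      then have "is_finite (ins a (del a Y))" by (rule is_finite_ins)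
      moreover have "Y \<^bold>\<subseteq> X" if "\<not> a \<^bold>\<in> Y" using that Y by (auto simp: subset_of_def)
      ultimately show "is_finite Y" using ins by (cases "a \<^bold>\<in> Y") (auto simp: ins_del)
    qed
  qed
  with assms show ?thesis by blast
qed

lemma finite_covered: "covered (\<lambda>u. u \<^bold>\<in> x) \<Longrightarrow> is_finite x"
  unfolding covered_def by (metis is_finite_subset subset_of_def)

lemma covered_finite: "is_finite x \<Longrightarrow> covered (\<lambda>u. u \<^bold>\<in> x)"
  unfolding covered_def by blast

lemma covered_eq: "covered (\<lambda>u. u = a)"
  unfolding covered_def by (rule exI[of _ "ins a emp"]) (simp add: is_finite_ins)

lemma covered_disj:
  assumes "covered P" "covered Q"
  shows "covered (\<lambda>u. P u \<or> Q u)"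
proof -
  obtain s t where s: "is_finite s" "\<And>u. P u \<Longrightarrow> u \<^bold>\<in> s" and t: "is_finite t" "\<And>u. Q u \<Longrightarrow> u \<^bold>\<in> t"
    using assms unfolding covered_def by blast
  from s(1) have "\<exists>z. is_finite z \<and> (\<forall>u. u \<^bold>\<in> s \<or> u \<^bold>\<in> t \<longrightarrow> u \<^bold>\<in> z)"
  proof (induction rule: is_finite_induct)
    case definable
    show ?case by (intro definable_intros)
  next
    case emp
    show ?case using t by auto
  next
    case (ins a X)
    then show ?case by (metis is_finite_ins mem_ins)
  qed
  with s t show ?thesis unfolding covered_def by blast
qed

text \<open>Induction on a finite set containing the indices; definability of \<open>R\<close> makes
  the claim definable. As \<open>R i\<close> must be covered for every \<open>i\<close>,
  applications build restrictions on \<open>i\<close> into \<open>R\<close>.\<close>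

lemma covered_UN:
  assumes "definable_rel R" "covered Q" "\<And>i. covered (R i)"
  shows "covered (\<lambda>u. \<exists>i. Q i \<and> R i u)"
proof -
  obtain s where s: "is_finite s" "\<And>u. Q u \<Longrightarrow> u \<^bold>\<in> s"
    using assms(2) unfolding covered_def by blast
  from s(1) have "\<exists>z. is_finite z \<and> (\<forall>u. (\<exists>i. i \<^bold>\<in> s \<and> R i u) \<longrightarrow> u \<^bold>\<in> z)"
  proof (induction rule: is_finite_induct)
    case definable
    show ?case by (intro definable_intros definable_relD[OF assms(1)])
  next
    case emp
    show ?case by (rule exI[of _ emp]) simp
  next
    case (ins a X)
    then have "covered (\<lambda>u. \<exists>i. i \<^bold>\<in> X \<and> R i u)" by (simp add: covered_def)
    from covered_disj[OF this assms(3)[of a]] show ?case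
      unfolding covered_def mem_ins by blast
  qed
  with s show ?thesis unfolding covered_def by blast
qed

section \<open>Standard cardinalities, counted in HOL\<close>

lemma numeral_card:
  "is_numeral n k \<Longrightarrow> is_natural k \<and> finite {z. z \<^bold>\<in> k} \<and> card {z. z \<^bold>\<in> k} = n"
proof (induction n arbitrary: k)
  case 0
  then show ?case by (simp add: is_empty_iff)
next
  case (Suc n)
  then obtain j where j: "is_numeral n j" "k = ins j j" by (auto simp: is_succ_iff)
  have "{z. z \<^bold>\<in> k} = insert j {z. z \<^bold>\<in> j}" using j by auto
  with Suc.IH[OF j(1)] j(2) show ?case by (simp add: natural_succ)
qed

lemma numeral_exists: "\<exists>k. is_numeral n k"
  by (induction n) (auto simp: is_empty_iff is_succ_iff)

lemma equipollent_bij_betw: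
  assumes "equipollent X k"
  shows "\<exists>h. bij_betw h {z. z \<^bold>\<in> X} {z. z \<^bold>\<in> k}"
proof -
  obtain R where R: "bij_rel R X k" using assms by (rule equipollentE)
  then obtain h where h: "\<And>a. a \<^bold>\<in> X \<Longrightarrow> R a (h a)" unfolding bij_rel_def by metis
  have "bij_betw h {z. z \<^bold>\<in> X} {z. z \<^bold>\<in> k}"
    unfolding bij_betw_def
  proof (intro conjI inj_onI)
    show "x = y" if "x \<in> {z. z \<^bold>\<in> X}" "y \<in> {z. z \<^bold>\<in> X}" "h x = h y" for x y
      using that h R unfolding bij_rel_def by (metis mem_Collect_eq)
    show "h ` {z. z \<^bold>\<in> X} = {z. z \<^bold>\<in> k}"
      using h R unfolding bij_rel_def by (auto simp: image_iff) metis+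
  qed
  then show ?thesis by blast
qed

lemma has_card_card:
  assumes "has_card n x"
  shows "finite {z. z \<^bold>\<in> x}" "card {z. z \<^bold>\<in> x} = n"
proof -
  obtain k where k: "is_numeral n k" "equipollent x k" using assms by (auto simp: has_card_def)
  then obtain h where "bij_betw h {z. z \<^bold>\<in> x} {z. z \<^bold>\<in> k}" using equipollent_bij_betw by blast
  with numeral_card[OF k(1)] show "finite {z. z \<^bold>\<in> x}" "card {z. z \<^bold>\<in> x} = n"
    by (auto simp: bij_betw_finite bij_betw_same_card)
qed

text \<open>\<open>x\<close> may have nonstandard size, so largeness is witnessed by an external set
  \<open>S\<close>. If its size were at most the numeral of \<open>n\<close>, then \<open>x\<close>
  would have at most \<open>n\<close> elements in HOL too.\<close>

lemma finite_card_gtI: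
  assumes "is_finite x" "\<And>u. u \<in> S \<Longrightarrow> u \<^bold>\<in> x" "n < card S"
  shows "finite_card_gt n x"
proof -
  obtain k where k: "is_natural k" "equipollent x k" using assms(1) by (auto simp: is_finite_def)
  obtain j where j: "is_numeral n j" using numeral_exists by blast
  have "j \<^bold>\<in> k"
  proof (rule ccontr)
    assume "\<not> j \<^bold>\<in> k"
    then have "{z. z \<^bold>\<in> k} \<subseteq> {z. z \<^bold>\<in> j}"
      using natural_linear[of j k] k j numeral_card by (auto simp: subset_of_def)
    then have "finite {z. z \<^bold>\<in> k}" "card {z. z \<^bold>\<in> k} \<le> n"
      using numeral_card[OF j] finite_subset card_mono by blast+
    moreover obtain h where "bij_betw h {z. z \<^bold>\<in> x} {z. z \<^bold>\<in> k}"
      using equipollent_bij_betw[OF k(2)] by blast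
    ultimately have "finite {z. z \<^bold>\<in> x}" "card {z. z \<^bold>\<in> x} \<le> n"
      by (auto simp: bij_betw_finite bij_betw_same_card)
    moreover have "S \<subseteq> {z. z \<^bold>\<in> x}" using assms(2) by auto
    ultimately show False using assms(3) card_mono[of "{z. z \<^bold>\<in> x}" S] by simp
  qed
  with k j show ?thesis unfolding finite_card_gt_def by blast
qed

subsection \<open>Splitting triples\<close>

text \<open>A nonempty proper part of a triple determines one of its elements: the part or its complement
  is a singleton.\<close>

lemma choice_if_splits:
  assumes t: "definable_rel t" and card3: "\<And>A. A \<^bold>\<in> F \<Longrightarrow> has_card 3 A"
    and inf: "\<not> covered (\<lambda>A. A \<^bold>\<in> F \<and> splits t A)"
  shows "\<exists>G. is_infinite G \<and> G \<^bold>\<subseteq> F \<and> (\<exists>U f. is_union U G \<and> is_function f G U \<and>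
    (\<forall>A a. A \<^bold>\<in> G \<and> maps_to f A a \<longrightarrow> a \<^bold>\<in> A))"
proof -
  have "definable (\<lambda>\<rho>. splits t (\<rho> 0))"
    unfolding splits_def by (intro definable_intros definable_relD[OF t])
  then obtain G where G: "\<And>A. A \<^bold>\<in> G \<longleftrightarrow> A \<^bold>\<in> F \<and> splits t A"
    by (rule separation_definable[of _ F]) blast
  have "is_infinite G"
    using inf covered_finite[of G] by (auto simp: G)
  moreover have "G \<^bold>\<subseteq> F" by (simp add: subset_of_def G)
  moreover obtain U where U: "is_union U G" using union by blast
  define sel where "sel A a \<longleftrightarrow> a \<^bold>\<in> A \<and> (t A a \<and> (\<forall>b. b \<^bold>\<in> A \<and> t A b \<longrightarrow> b = a) \<or>
    \<not> t A a \<and> (\<forall>b. b \<^bold>\<in> A \<and> \<not> t A b \<longrightarrow> b = a))" for A a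
  have "definable_rel sel"
    unfolding sel_def by (intro definable_relI definable_intros definable_relD[OF t])
  then obtain f where f: "\<And>p. p \<^bold>\<in> f \<longleftrightarrow> (\<exists>A a. A \<^bold>\<in> G \<and> a \<^bold>\<in> U \<and> sel A a \<and> p = pr A a)"
    using relation_set by blast
  have sel: "\<exists>!a. sel A a" if "A \<^bold>\<in> G" for A
  proof -
    have "card {z. z \<^bold>\<in> A} = 3" using that has_card_card(2) card3 G by blast
    then obtain a b c where "{z. z \<^bold>\<in> A} = {a, b, c}" and ne: "a \<noteq> b" "b \<noteq> c" "a \<noteq> c"
      by (auto simp: card_3_iff)
    then have A: "z \<^bold>\<in> A \<longleftrightarrow> z = a \<or> z = b \<or> z = c" for z by blast
    have "splits t A" using that G by blast
    then show ?thesis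
      unfolding splits_def sel_def A using ne
      by (cases "t A a"; cases "t A b"; cases "t A c") auto
  qed
  have maps: "maps_to f A a \<longleftrightarrow> A \<^bold>\<in> G \<and> sel A a" for A a
    using U by (auto simp: maps_to_iff f is_union_def sel_def)
  have "is_function f G U"
    unfolding is_function_def maps is_opair_iff f using sel by blast
  moreover have "\<forall>A a. A \<^bold>\<in> G \<and> maps_to f A a \<longrightarrow> a \<^bold>\<in> A"
    by (simp add: maps sel_def)
  ultimately show ?thesis using U by blast
qed

section \<open>The combinatorial core\<close>

text \<open>In the application, \<open>H E A a\<close> says that \<open>f\<close> picks the point
  \<open>a\<close> of \<open>A\<close> from the union of the family \<open>E\<close>. Only two facts
  about \<open>f\<close> enter: finite families with two members have a split member, and no
  definable relation splits infinitely many members of \<open>F\<close>.\<close>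

lemma finite_if_hit:
  assumes H: "\<And>i j k. definable (\<lambda>\<rho>. H (\<rho> i) (\<rho> j) (\<rho> k))"
    and hit: "\<And>E A B. is_finite E \<Longrightarrow> E \<^bold>\<subseteq> F \<Longrightarrow> A \<^bold>\<in> E \<Longrightarrow> B \<^bold>\<in> E \<Longrightarrow> A \<noteq> B \<Longrightarrow>
      \<exists>C. C \<^bold>\<in> E \<and> splits (H E) C"
    and fin: "\<And>t. definable_rel t \<Longrightarrow> covered (\<lambda>A. A \<^bold>\<in> F \<and> splits t A)"
  shows "is_finite F"
proof (rule ccontr)
  assume "is_infinite F"
  then have infF: "\<not> covered (\<lambda>A. A \<^bold>\<in> F)" using finite_covered by blast
  \<comment> \<open>The pair enters through a quantified \<open>E\<close>, since definability of
    \<open>H\<close> is given for variables only; \<open>N_iff\<close> restates this with a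
    term.\<close>
  define N where "N A B \<longleftrightarrow> A \<^bold>\<in> F \<and> B \<^bold>\<in> F \<and> B \<noteq> A \<and>
    (\<exists>E. is_upair E A B \<and> splits (H E) B)" for A B
  have N_iff: "N A B \<longleftrightarrow> A \<^bold>\<in> F \<and> B \<^bold>\<in> F \<and> B \<noteq> A \<and> splits (H (ins A (ins B emp))) B" for A B
    by (simp add: N_def is_upair_iff)
  have N_definable: "definable_rel N"
    unfolding N_def splits_def by (intro definable_relI definable_intros H)
  have N_F: "A \<^bold>\<in> F" "B \<^bold>\<in> F" "A \<noteq> B" if "N A B" for A B
    using that by (auto simp: N_def)
  have N_finite: "covered (N A)" for A
  proof -
    \<comment> \<open>With \<open>A\<close> as a parameter, cutting \<open>B\<close> by the choice
      for the pair is one definable relation, and it splits every \<open>B\<close> in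
      \<open>N A\<close>.\<close>
    define t where "t B b \<longleftrightarrow> (\<exists>E. is_upair E A B \<and> H E B b)" for B b
    have "definable_rel t"
      unfolding t_def by (intro definable_relI definable_intros H)
    from fin[OF this] show ?thesis
      by (rule covered_mono) (auto simp: N_iff t_def is_upair_iff splits_def)
  qed
  have N_total: "N A B \<or> N B A" if AB: "A \<^bold>\<in> F" "B \<^bold>\<in> F" "A \<noteq> B" for A B
  proof -
    have "is_finite (ins A (ins B emp))" by (simp add: is_finite_ins)
    moreover have "ins A (ins B emp) \<^bold>\<subseteq> F" using that by (auto simp: subset_of_def)
    ultimately obtain C where "C \<^bold>\<in> ins A (ins B emp)" "splits (H (ins A (ins B emp))) C"
      using hit[of "ins A (ins B emp)" A B] AB(3) by auto
    moreover have "ins A (ins B emp) = ins B (ins A emp)" by (rule same_elements_eqI) auto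
    ultimately show ?thesis using that by (auto simp: N_iff)
  qed

  \<comment> \<open>The number of elements of \<open>N A\<close>, as a natural number of the
    model.\<close>
  define size where "size A k \<longleftrightarrow> is_natural k \<and>
    (\<exists>s. (\<forall>B. B \<^bold>\<in> s \<longleftrightarrow> N A B) \<and> equipollent s k)" for A k
  define same where "same A B \<longleftrightarrow> (\<exists>k. size A k \<and> size B k)" for A B
  have size_definable: "definable_rel size"
    unfolding size_def by (intro definable_relI definable_intros definable_relD[OF N_definable])
  have same_definable: "definable_rel same"
    unfolding same_def by (intro definable_relI definable_intros definable_relD[OF size_definable])
  have N_set: "\<exists>s. \<forall>B. B \<^bold>\<in> s \<longleftrightarrow> N A B" for A
  proof -
    have "definable (\<lambda>\<rho>. N A (\<rho> 0))" by (intro definable_intros definable_relD[OF N_definable])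
    then obtain s where "\<And>B. B \<^bold>\<in> s \<longleftrightarrow> B \<^bold>\<in> F \<and> N A B"
      by (rule separation_definable[of _ F]) blast
    then show ?thesis by (intro exI[of _ s]) (auto simp: N_def)
  qed
  have size_ex: "\<exists>k. size A k" for A
  proof -
    obtain s where s: "\<forall>B. B \<^bold>\<in> s \<longleftrightarrow> N A B" using N_set by blast
    then have "is_finite s" using N_finite[of A] finite_covered[of s] by simp
    with s show ?thesis by (auto simp: size_def is_finite_def)
  qed
  have size_unique: "k = j" if kj: "size A k" "size A j" for A k j
  proof -
    obtain s t where *: "\<forall>B. B \<^bold>\<in> s \<longleftrightarrow> N A B" "\<forall>B. B \<^bold>\<in> t \<longleftrightarrow> N A B"
      "equipollent s k" "equipollent t j" "is_natural k" "is_natural j"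
      using kj unfolding size_def by blast
    then have "s = t" by (intro same_elements_eqI) simp
    with * show ?thesis using equipollent_natural_unique by blast
  qed
  \<comment> \<open>\<open>N A\<close> lies in \<open>N B\<close> and has the same size, so the
    pigeonhole principle makes them equal.\<close>
  have same_subset: "N A C" if AB: "same A B" "\<And>C. N A C \<Longrightarrow> N B C" "N B C" for A B C
  proof -
    obtain s t k where *: "\<forall>B. B \<^bold>\<in> s \<longleftrightarrow> N A B" "\<forall>C. C \<^bold>\<in> t \<longleftrightarrow> N B C"
      "equipollent s k" "equipollent t k" "is_natural k"
      using AB(1) unfolding same_def size_def by blast
    then have "s \<^bold>\<subseteq> t" using AB(2) by (simp add: subset_of_def)
    then have "s = t" using * pigeonhole by blast
    with * AB(3) show ?thesis by blast
  qed

  text \<open>If \<open>C\<close> is outside the finite set \<open>N B\<close>, then \<open>B\<close> is in \<open>N C\<close>.  So \<open>N A \<union> {A} \<subseteq> N C\<close> for all but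
    finitely many \<open>C\<close>, and these have size different from that of \<open>A\<close> by the pigeonhole principle.\<close>
  have cofinite: "covered (\<lambda>C. C \<^bold>\<in> F \<and> \<not> (N C A \<and> (\<forall>B. N A B \<longrightarrow> N C B)))" if "A \<^bold>\<in> F" for A
  proof -
    \<comment> \<open>\<open>C = B\<close> is excluded as well because \<open>N_total\<close> is
      about distinct members.\<close>
    define R where "R B C \<longleftrightarrow> C = B \<or> N B C" for B C
    have R: "definable_rel R"
      unfolding R_def by (intro definable_relI definable_intros definable_relD[OF N_definable])
    have "covered (R B)" for B
      unfolding R_def by (intro covered_disj covered_eq N_finite)
    from covered_UN[OF R N_finite[of A] this] this[of A]
    have "covered (\<lambda>C. (\<exists>B. N A B \<and> R B C) \<or> R A C)" by (rule covered_disj)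
    then show ?thesis
      by (rule covered_mono) (use N_total N_F that in \<open>unfold R_def, blast\<close>)
  qed
  have same_finite: "covered (\<lambda>C. C \<^bold>\<in> F \<and> same A C)" if "A \<^bold>\<in> F" for A
  proof (rule covered_mono[OF cofinite[OF that]])
    fix C assume C: "C \<^bold>\<in> F \<and> same A C"
    \<comment> \<open>Equal sizes would turn the inclusion of \<open>N A\<close> in
      \<open>N C\<close> into equality, and \<open>A\<close> in \<open>N C\<close> would give
      \<open>A\<close> in \<open>N A\<close>.\<close>
    have "\<not> N A A" by (simp add: N_def)
    with C same_subset[of A C A] show "C \<^bold>\<in> F \<and> \<not> (N C A \<and> (\<forall>B. N A B \<longrightarrow> N C B))" by blast
  qed

  define twin where "twin A \<longleftrightarrow> A \<^bold>\<in> F \<and> (\<exists>B. B \<^bold>\<in> F \<and> B \<noteq> A \<and> same A B)" for A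
  have twin_finite: "covered twin"
  proof -
    \<comment> \<open>\<open>t\<close> cuts \<open>A\<close> by the choice made for its whole size
      class.\<close>
    define t where "t A a \<longleftrightarrow> (\<exists>k. size A k \<and>
      (\<exists>E. (\<forall>B. B \<^bold>\<in> E \<longleftrightarrow> B \<^bold>\<in> F \<and> size B k) \<and> H E A a))" for A a
    define R where "R B A \<longleftrightarrow> B \<^bold>\<in> F \<and> A \<^bold>\<in> F \<and> same B A" for B A
    have "definable_rel t"
      unfolding t_def by (intro definable_relI definable_intros H definable_relD[OF size_definable])
    note fin_t = fin[OF this]
    have "definable_rel R"
      unfolding R_def by (intro definable_relI definable_intros definable_relD[OF same_definable])
    moreover have "covered (R B)" for B
      by (cases "B \<^bold>\<in> F", rule covered_mono[OF same_finite[of B]],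
          auto simp: R_def intro: covered_mono[OF covered_eq])
    ultimately have "covered (\<lambda>A. \<exists>B. (B \<^bold>\<in> F \<and> splits t B) \<and> R B A)"
      using fin_t by (intro covered_UN)
    then show ?thesis
    proof (rule covered_mono)
      \<comment> \<open>The size class of a twin is finite with at least two members, so
        \<open>hit\<close> yields a split member \<open>C\<close>. Hence the twin lies in the class
        of one of the finitely many members split by \<open>t\<close>.\<close>
      fix A assume "twin A"
      then obtain B k where A: "A \<^bold>\<in> F" "B \<^bold>\<in> F" "B \<noteq> A" "size A k" "size B k"
        by (auto simp: twin_def same_def)
      have "definable (\<lambda>\<rho>. size (\<rho> 0) k)" by (intro definable_intros definable_relD[OF size_definable])
      then obtain E where E: "\<And>C. C \<^bold>\<in> E \<longleftrightarrow> C \<^bold>\<in> F \<and> size C k"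
        by (rule separation_definable[of _ F]) blast
      have "covered (\<lambda>C. C \<^bold>\<in> E)"
        by (rule covered_mono[OF same_finite[OF A(1)]]) (use A in \<open>auto simp: E same_def\<close>)
      then have "is_finite E" by (rule finite_covered)
      moreover have "E \<^bold>\<subseteq> F" by (simp add: subset_of_def E)
      ultimately obtain C where C: "C \<^bold>\<in> E" "splits (H E) C" using hit[of E A B] A E by blast
      have "t C c \<longleftrightarrow> H E C c" for c
      proof -
        have "E' = E" if "\<forall>B. B \<^bold>\<in> E' \<longleftrightarrow> B \<^bold>\<in> F \<and> size B k" for E'
          by (rule same_elements_eqI) (simp add: that E)
        then show ?thesis using size_unique C(1) E unfolding t_def by blast
      qed
      then have "splits t C" using C(2) splits_cong[of t C "H E"] by blast
      then show "\<exists>B. (B \<^bold>\<in> F \<and> splits t B) \<and> R B A"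
        using C E A by (auto simp: R_def same_def)
    qed
  qed

  text \<open>A triple without twins is determined by its size, so every \<open>A\<close> can be paired with the one of
    least size among those twinless \<open>B\<close> for which \<open>A\<close> is in \<open>N B\<close>.\<close>
  define cand where "cand A B k \<longleftrightarrow> B \<^bold>\<in> F \<and> \<not> twin B \<and> N B A \<and> size B k" for A B k
  define best where "best A B \<longleftrightarrow> (\<exists>k. cand A B k \<and> (\<forall>C j. cand A C j \<longrightarrow> k \<^bold>\<subseteq> j))" for A B
  have best_ex: "\<exists>B. best A B" if "A \<^bold>\<in> F" for A
  proof -
    have "\<exists>B. B \<^bold>\<in> F \<and> \<not> twin B \<and> N B A"
    proof (rule ccontr)
      assume none: "\<not> ?thesis"
      \<comment> \<open>Without a candidate, totality puts every twinless \<open>B\<close> other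
        than \<open>A\<close> into \<open>N A\<close>, so \<open>F\<close> would be finite.\<close>
      have "covered (\<lambda>B. twin B \<or> (B = A \<or> N A B))"
        by (intro covered_disj covered_eq N_finite twin_finite)
      then have "covered (\<lambda>B. B \<^bold>\<in> F)"
        by (rule covered_mono) (use none N_total that in blast)
      with infF show False by blast
    qed
    then obtain B k where "cand A B k" using size_ex unfolding cand_def by blast
    moreover have "definable (\<lambda>\<rho>. \<exists>B. cand A B (\<rho> 0))"
      unfolding cand_def twin_def
      by (intro definable_intros definable_relD[OF size_definable] definable_relD[OF same_definable]
          definable_relD[OF N_definable])
    moreover have "is_natural k" if "\<exists>B. cand A B k" for k
      using that by (auto simp: cand_def size_def)
    ultimately have "\<exists>m. (\<exists>B. cand A B m) \<and> (\<forall>j. (\<exists>C. cand A C j) \<longrightarrow> m \<^bold>\<subseteq> j)"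
      by (intro natural_least[where K = "\<lambda>k. \<exists>B. cand A B k"]) blast+
    then show ?thesis unfolding best_def by blast
  qed
  have best_unique: "B = C" if BC: "best A B" "best A C" for A B C
  proof -
    obtain k j where "cand A B k" "cand A C j" "k \<^bold>\<subseteq> j" "j \<^bold>\<subseteq> k"
      using BC unfolding best_def by blast
    \<comment> \<open>If distinct, \<open>B\<close> and \<open>C\<close> would be twins, being
      members of \<open>F\<close> of equal size.\<close>
    moreover from this have "k = j" using subset_of_antisym by blast
    ultimately show ?thesis unfolding cand_def twin_def same_def by blast
  qed
  \<comment> \<open>Since \<open>A\<close> is in \<open>N B\<close> for its best partner
    \<open>B\<close>, this relation splits every member of \<open>F\<close>, contrary to
    \<open>fin\<close>.\<close>
  define t where "t A a \<longleftrightarrow> (\<exists>B. best A B \<and> (\<exists>E. is_upair E B A \<and> H E A a))" for A a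
  have "definable_rel t"
    unfolding t_def best_def cand_def twin_def
    by (intro definable_relI definable_intros H definable_relD[OF size_definable]
        definable_relD[OF same_definable] definable_relD[OF N_definable])
  then have "covered (\<lambda>A. A \<^bold>\<in> F \<and> splits t A)" by (rule fin)
  then have "covered (\<lambda>A. A \<^bold>\<in> F)"
  proof (rule covered_mono)
    fix A assume A: "A \<^bold>\<in> F"
    then obtain B where B: "best A B" using best_ex by blast
    then have "t A a \<longleftrightarrow> H (ins B (ins A emp)) A a" for a
      using best_unique unfolding t_def is_upair_iff by blast
    moreover have "splits (H (ins B (ins A emp))) A"
      using B by (auto simp: best_def cand_def N_iff)
    ultimately show "A \<^bold>\<in> F \<and> splits t A" using A splits_cong[of t A] by blast
  qed
  with infF show False by blast
qed

section \<open>From the Ramsey choice function to a choice on triples\<close>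

lemma has_card_finite: "has_card n x \<Longrightarrow> is_finite x"
  unfolding has_card_def is_finite_def using numeral_card by blast

text \<open>A finite disjoint sum of finite sets is finite. This gives finiteness of the unions to
  which \<open>f\<close> is applied, and in the end of \<open>y\<close>.\<close>

lemma covered_UN_pr:
  assumes "covered Q" "\<And>A. Q A \<Longrightarrow> is_finite A" "definable (\<lambda>\<rho>. Q (\<rho> 0))"
  shows "covered (\<lambda>p. \<exists>A a. Q A \<and> a \<^bold>\<in> A \<and> p = pr A a)"
proof -
  have *: "covered (\<lambda>p. \<exists>a. a \<^bold>\<in> A \<and> is_opair p A a)" if "is_finite A" for A
  proof (rule covered_UN)
    show "definable_rel (\<lambda>a p. is_opair p A a)" by (intro definable_relI definable_intros)
    show "covered (\<lambda>a. a \<^bold>\<in> A)" using that by (rule covered_finite)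
    show "covered (\<lambda>p. is_opair p A a)" for a unfolding is_opair_iff by (rule covered_eq)
  qed
  define R where "R A p \<longleftrightarrow> is_finite A \<and> (\<exists>a. a \<^bold>\<in> A \<and> is_opair p A a)" for A p
  have "definable_rel R" unfolding R_def by (intro definable_relI definable_intros)
  moreover have "covered (R A)" for A
    by (cases "is_finite A", rule covered_mono[OF *[of A]],
        auto simp: R_def intro: covered_mono[OF covered_eq])
  ultimately have "covered (\<lambda>p. \<exists>A. Q A \<and> R A p)" using assms(1) by (intro covered_UN)
  then show ?thesis
    by (rule covered_mono) (use assms(2) in \<open>auto simp: R_def is_opair_iff\<close>)
qed

lemma C_minus_3_if_4RC_fin:
  assumes "nRC_fin 4"
  shows "C_minus 3"
  unfolding C_minus_def
proof (intro allI impI, rule ccontr)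
  fix F
  assume F: "is_infinite F \<and> (\<forall>A. A \<^bold>\<in> F \<longrightarrow> \<not> is_empty A \<and> has_card 3 A)"
  assume "\<not> (\<exists>G. is_infinite G \<and> G \<^bold>\<subseteq> F \<and> (\<exists>U f. is_union U G \<and> is_function f G U \<and>
    (\<forall>A a. A \<^bold>\<in> G \<and> maps_to f A a \<longrightarrow> a \<^bold>\<in> A)))"
  then have fin: "covered (\<lambda>A. A \<^bold>\<in> F \<and> splits t A)" if "definable_rel t" for t
    using choice_if_splits[OF that, of F] F by blast
  obtain U where U: "is_union U F" using union by blast
  have "definable_rel (\<lambda>A a. a \<^bold>\<in> A)" by (intro definable_relI definable_intros)
  \<comment> \<open>Tagging each point with its triple makes the triples disjoint.\<close>
  then obtain x where "\<And>p. p \<^bold>\<in> x \<longleftrightarrow> (\<exists>A a. A \<^bold>\<in> F \<and> a \<^bold>\<in> U \<and> a \<^bold>\<in> A \<and> p = pr A a)"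
    using relation_set by blast
  then have x: "p \<^bold>\<in> x \<longleftrightarrow> (\<exists>A a. A \<^bold>\<in> F \<and> a \<^bold>\<in> A \<and> p = pr A a)" for p
    using U unfolding is_union_def by blast
  \<comment> \<open>The first coordinates of the pairs in \<open>x\<close> exhaust \<open>F\<close>,
    as triples are nonempty.\<close>
  have "is_infinite x"
  proof
    assume "is_finite x"
    then have "covered (\<lambda>p. p \<^bold>\<in> x)" by (rule covered_finite)
    moreover have "definable_rel (\<lambda>p A. \<exists>a. is_opair p A a)"
      by (intro definable_relI definable_intros)
    moreover have "covered (\<lambda>A. \<exists>a. is_opair p A a)" for p
    proof (cases "\<exists>A a. p = pr A a")
      case True
      then obtain B b where "p = pr B b" by blast
      then show ?thesis by (intro covered_mono[OF covered_eq[of B]]) (auto simp: is_opair_iff)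
    next
      case False
      then show ?thesis by (intro covered_mono[OF covered_eq]) (auto simp: is_opair_iff)
    qed
    ultimately have "covered (\<lambda>A. \<exists>p. p \<^bold>\<in> x \<and> (\<exists>a. is_opair p A a))" by (intro covered_UN)
    then have "covered (\<lambda>A. A \<^bold>\<in> F)"
    proof (rule covered_mono)
      fix A assume "A \<^bold>\<in> F"
      moreover from this obtain a where "a \<^bold>\<in> A" using F unfolding is_empty_def by blast
      ultimately show "\<exists>p. p \<^bold>\<in> x \<and> (\<exists>a. is_opair p A a)" unfolding x is_opair_iff by blast
    qed
    with F finite_covered show False by blast
  qed
  then obtain y D R f where y: "is_infinite y" "y \<^bold>\<subseteq> x"
    and D: "is_finite_subsets_gt D 4 y" and R: "is_subsets_card R 4 y" and f: "is_function f D R"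
    and sub: "\<And>z w. z \<^bold>\<in> D \<Longrightarrow> maps_to f z w \<Longrightarrow> w \<^bold>\<subseteq> z"
    using assms unfolding nRC_fin_def by blast
  have "definable (\<lambda>\<rho>. \<forall>a. a \<^bold>\<in> \<rho> 0 \<longrightarrow> maps_to y (\<rho> 0) a)" by (intro definable_intros)
  \<comment> \<open>\<open>F'\<close> keeps the triples lying wholly in \<open>y\<close>; any other
    triple that meets \<open>y\<close> is split by \<open>maps_to y\<close>.\<close>
  then obtain F' where "\<And>A. A \<^bold>\<in> F' \<longleftrightarrow> A \<^bold>\<in> F \<and> (\<forall>a. a \<^bold>\<in> A \<longrightarrow> maps_to y A a)"
    by (rule separation_definable[of _ F]) blast
  then have F': "A \<^bold>\<in> F' \<longleftrightarrow> A \<^bold>\<in> F \<and> (\<forall>a. a \<^bold>\<in> A \<longrightarrow> pr A a \<^bold>\<in> y)" for A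
    by (simp add: maps_to_iff)

  \<comment> \<open>\<open>z\<close> is the part of \<open>y\<close> over \<open>E\<close>, and
    \<open>w\<close> is the set of four points that \<open>f\<close> chooses from it.\<close>
  define H where "H E A a \<longleftrightarrow> (\<exists>z w. (\<forall>p. p \<^bold>\<in> z \<longleftrightarrow> p \<^bold>\<in> y \<and> (\<exists>B b. B \<^bold>\<in> E \<and> is_opair p B b)) \<and>
    maps_to f z w \<and> maps_to w A a)" for E A a
  have "is_finite F'"
  proof (rule finite_if_hit[where H = H])
    show "definable (\<lambda>\<rho>. H (\<rho> i) (\<rho> j) (\<rho> k))" for i j k
      unfolding H_def by (intro definable_intros)
    show "covered (\<lambda>A. A \<^bold>\<in> F' \<and> splits t A)" if "definable_rel t" for t
      using fin[OF that] by (rule covered_mono) (simp add: F')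
    fix E A B
    assume E: "is_finite E" "E \<^bold>\<subseteq> F'" and AB: "A \<^bold>\<in> E" "B \<^bold>\<in> E" "A \<noteq> B"
    have "definable (\<lambda>\<rho>. \<exists>B b. B \<^bold>\<in> E \<and> is_opair (\<rho> 0) B b)" by (intro definable_intros)
    then obtain z where z: "\<And>p. p \<^bold>\<in> z \<longleftrightarrow> p \<^bold>\<in> y \<and> (\<exists>B b. B \<^bold>\<in> E \<and> is_opair p B b)"
      by (rule separation_definable[of _ y]) blast
    have EF: "C \<^bold>\<in> F" if "C \<^bold>\<in> E" for C using E that by (auto simp: subset_of_def F')
    have zD: "\<exists>C c. C \<^bold>\<in> E \<and> c \<^bold>\<in> C \<and> p = pr C c" if p: "p \<^bold>\<in> z" for p
    proof -
      obtain C c where "C \<^bold>\<in> E" "p = pr C c" using p by (auto simp: z is_opair_iff)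
      moreover obtain A a where "a \<^bold>\<in> A" "p = pr A a" using p y(2) z x unfolding subset_of_def by blast
      ultimately show ?thesis by auto
    qed
    have zI: "pr C c \<^bold>\<in> z" if "C \<^bold>\<in> E" "c \<^bold>\<in> C" for C c
      using that E(2) unfolding z subset_of_def F' is_opair_iff by blast
    \<comment> \<open>Fibres are external HOL sets, so that 3, 4 and 6 points can be counted with
      \<open>card\<close>.\<close>
    define fib where "fib C = pr C ` {c. c \<^bold>\<in> C}" for C
    have card_fib: "finite (fib C)" "card (fib C) = 3" if "C \<^bold>\<in> E" for C
      unfolding fib_def using has_card_card[of 3 C] F EF[OF that]
      by (auto simp: card_image inj_on_def)
    have card_fib2: "card (fib C \<union> fib C') = 6" if "C \<^bold>\<in> E" "C' \<^bold>\<in> E" "C \<noteq> C'" for C C'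
    proof -
      have "fib C \<inter> fib C' = {}" using that(3) by (auto simp: fib_def)
      then show ?thesis using card_fib that by (simp add: card_Un_disjoint)
    qed
    have "covered (\<lambda>p. \<exists>C c. C \<^bold>\<in> E \<and> c \<^bold>\<in> C \<and> p = pr C c)"
      by (rule covered_UN_pr)
        (use E EF F in \<open>auto intro: covered_finite has_card_finite definable_intros\<close>)
    then have "is_finite z" using zD by (intro finite_covered) (rule covered_mono)
    \<comment> \<open>Two fibres already contain six points, enough for \<open>f\<close> to be
      defined at \<open>z\<close>.\<close>
    then have "finite_card_gt 4 z"
      by (rule finite_card_gtI[of _ "fib A \<union> fib B"])
        (use AB zI card_fib2 in \<open>auto simp: fib_def\<close>)
    then have "z \<^bold>\<in> D" using D z by (auto simp: is_finite_subsets_gt_def subset_of_def)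
    then obtain w where w: "maps_to f z w" and w_unique: "\<And>v. maps_to f z v \<Longrightarrow> v = w"
      using f unfolding is_function_def by blast
    have H_iff: "H E C c \<longleftrightarrow> pr C c \<^bold>\<in> w" for C c
    proof -
      have "z' = z" if "\<forall>p. p \<^bold>\<in> z' \<longleftrightarrow> p \<^bold>\<in> y \<and> (\<exists>B b. B \<^bold>\<in> E \<and> is_opair p B b)" for z'
        by (rule same_elements_eqI) (simp add: that z)
      then have "H E C c \<longleftrightarrow> maps_to w C c" using w w_unique z unfolding H_def by metis
      then show ?thesis by (simp add: maps_to_iff)
    qed
    have "w \<^bold>\<in> R"
    proof -
      have "pr z w \<^bold>\<in> f" using w by (simp add: maps_to_iff)
      then obtain z' w' where "w' \<^bold>\<in> R" "pr z w = pr z' w'"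
        using f unfolding is_function_def is_opair_iff by blast
      then show ?thesis by simp
    qed
    then have card_w: "finite {p. p \<^bold>\<in> w}" "card {p. p \<^bold>\<in> w} = 4"
      using R has_card_card unfolding is_subsets_card_def by blast+
    have "w \<^bold>\<subseteq> z" using sub \<open>z \<^bold>\<in> D\<close> w by blast
    show "\<exists>C. C \<^bold>\<in> E \<and> splits (H E) C"
    proof (rule ccontr)
      assume none: "\<not> ?thesis"
      \<comment> \<open>If nothing is split, \<open>w\<close> is a union of whole fibres.\<close>
      have full: "\<exists>C. C \<^bold>\<in> E \<and> p \<in> fib C \<and> fib C \<subseteq> {p. p \<^bold>\<in> w}" if p: "p \<^bold>\<in> w" for p
      proof -
        obtain C c where C: "C \<^bold>\<in> E" "c \<^bold>\<in> C" "p = pr C c"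
          using p \<open>w \<^bold>\<subseteq> z\<close> zD unfolding subset_of_def by blast
        with p none have "\<forall>c. c \<^bold>\<in> C \<longrightarrow> pr C c \<^bold>\<in> w" unfolding splits_def H_iff by blast
        with C show ?thesis by (auto simp: fib_def)
      qed
      obtain p where "p \<^bold>\<in> w" using card_w(2) by (cases "{p. p \<^bold>\<in> w} = {}") auto
      then obtain C where C: "C \<^bold>\<in> E" "fib C \<subseteq> {p. p \<^bold>\<in> w}" using full by blast
      \<comment> \<open>A fibre has 3 points and \<open>w\<close> has 4, so \<open>w\<close>
        contains a second fibre and thus at least 6 points.\<close>
      then have "fib C \<noteq> {p. p \<^bold>\<in> w}" using card_fib(2)[of C] card_w(2) by auto
      then obtain q where q: "q \<^bold>\<in> w" "q \<notin> fib C" using C(2) by blast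
      then obtain C' where C': "C' \<^bold>\<in> E" "q \<in> fib C'" "fib C' \<subseteq> {p. p \<^bold>\<in> w}" using full by blast
      then have "C \<noteq> C'" using q by blast
      then have "6 \<le> card {p. p \<^bold>\<in> w}"
        using card_fib2[OF C(1) C'(1)] card_mono[OF card_w(1), of "fib C \<union> fib C'"] C(2) C'(3) by simp
      with card_w(2) show False by simp
    qed
  qed
  \<comment> \<open>Every point of \<open>y\<close> lies over a triple in \<open>F'\<close> or over
    one split by \<open>maps_to y\<close>. Both families are finite, so \<open>y\<close> would be
    finite.\<close>
  then have "covered (\<lambda>A. A \<^bold>\<in> F')" by (rule covered_finite)
  moreover have "definable_rel (maps_to y)" by (intro definable_relI definable_intros)
  from fin[OF this] have "covered (\<lambda>A. A \<^bold>\<in> F \<and> splits (maps_to y) A)" .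
  ultimately have "covered (\<lambda>A. A \<^bold>\<in> F' \<or> A \<^bold>\<in> F \<and> splits (maps_to y) A)"
    by (rule covered_disj)
  moreover have "definable (\<lambda>\<rho>. \<rho> 0 \<^bold>\<in> F' \<or> \<rho> 0 \<^bold>\<in> F \<and> splits (maps_to y) (\<rho> 0))"
    unfolding splits_def by (intro definable_intros)
  moreover have "is_finite A" if "A \<^bold>\<in> F' \<or> A \<^bold>\<in> F \<and> splits (maps_to y) A" for A
    using that F has_card_finite F' by blast
  ultimately have "covered (\<lambda>p. \<exists>A a. (A \<^bold>\<in> F' \<or> A \<^bold>\<in> F \<and> splits (maps_to y) A) \<and>
      a \<^bold>\<in> A \<and> p = pr A a)"
    by (intro covered_UN_pr)
  then have "covered (\<lambda>p. p \<^bold>\<in> y)"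
  proof (rule covered_mono)
    fix p assume p: "p \<^bold>\<in> y"
    then obtain A a where "A \<^bold>\<in> F" "a \<^bold>\<in> A" "p = pr A a"
      using y(2) x by (auto simp: subset_of_def)
    with p show "\<exists>A a. (A \<^bold>\<in> F' \<or> A \<^bold>\<in> F \<and> splits (maps_to y) A) \<and> a \<^bold>\<in> A \<and> p = pr A a"
      unfolding splits_def F' maps_to_iff by blast
  qed
  with y(1) finite_covered show False by blast
qed

end

theorem mainTheorem5:
  fixes mem :: "'a \<Rightarrow> 'a \<Rightarrow> bool"
  assumes "ZF mem"
    and "membership.nRC_fin mem 4"
  shows "membership.C_minus mem 3"
proof -
  interpret ZF mem by (rule assms(1))
  show ?thesis using assms(2) by (rule C_minus_3_if_4RC_fin)
qed

end
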